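(* Let $(L,[-,-],d)$ be a differential Lie algebra of weight $\lambda$ and let $D:L\to L$ be a linear map that is adjoint-admissible to $(L,[-,-],d)$. If $r\in L\otimes L$ is a solution of the $D$-differential classical Yang-Baxter equation, that is, $\operatorname{CYB}(r)=0$ and $(D\otimes\mathrm{id}-\mathrm{id}\otimes d)(r)=0$, and $r=-\tau(r)$, then $(L,[-,-],d,\delta_r,D)$ is a differential Lie bialgebra, where $\delta_r:L\to L\otimes L$ is defined by $\delta_r(x)=(\mathrm{ad}_x\otimes\mathrm{id}+\mathrm{id}\otimes\mathrm{ad}_x)(r)$.
   Context: All vector spaces are finite-dimensional over a field $\mathbf k$, and $\lambda\in\mathbf k$; $\langle\cdot,\cdot\rangle$ is the natural pairing of a space with its dual; $\tau(x\otimes y)=y\otimes x$; $\mathrm{ad}_x(y)=[x,y]$. **Differential Lie algebra of weight $\lambda$** $(L,[-,-],d)$: a Lie algebra with a linear map $d$ such that $d([x,y])=[d(x),y]+[x,d(y)]+\lambda[d(x),d(y)]$. A **representation** of it is $(V,\rho,\xi)$ with $(V,\rho)$ a representation of the Lie algebra and $\xi:V\to V$ linear such that $\xi(\rho(x)v)=\rho(d(x))v+\rho(x)\xi(v)+\lambda\rho(d(x))\xi(v)$. **Adjoint-admissible.** A linear map $\pi:L\to L$ is adjoint-admissible to $(L,[-,-],d)$ if $(L^*,\mathrm{ad}^*,\pi^* )$ is a representation of $(L,[-,-],d)$, where $\langle\mathrm{ad}^*(x)b^*,y\rangle=-\langle b^*,[x,y]\rangle$ and $\langle\pi^*(b^*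 ),y\rangle=\langle b^*,\pi(y)\rangle$; equivalently $[x,\pi(y)]=[d(x),y]+\pi([x,y])+\lambda\pi([d(x),y])$ for all $x,y\in L$. **CYBE.** Write $r=r_1\otimes r_2$ (summation suppressed), with $\bar r_1\otimes\bar r_2$ a second copy of $r$. Then $\operatorname{CYB}(r)=[r_1,\bar r_1]\otimes r_2\otimes\bar r_2+r_1\otimes\bar r_1\otimes[r_2,\bar r_2]+r_1\otimes[r_2,\bar r_1]\otimes\bar r_2$. **Differential Lie coalgebra of weight $\lambda$** $(L,\delta,D)$: a Lie coalgebra $(L,\delta)$ with a linear map $D$ such that $\delta D=(D\otimes\mathrm{id})\delta+(\mathrm{id}\otimes D)\delta+\lambda(D\otimes D)\delta$. **Lie bialgebra** $(L,[-,-],\delta)$: a Lie algebra and Lie coalgebra with $\delta([x,y])=(\mathrm{ad}_x\otimes\mathrm{id}+\mathrm{id}\otimes\mathrm{ad}_x)\delta(y)-(\mathrm{ad}_y\otimes\mathrm{id}+\mathrm{id}\otimes\mathrm{ad}_y)\delta(x)$. **Differential Lie bialgebra** $(L,[-,-],d,\delta,D)$: $(L,[-,-],\delta)$ is a Lie bialgebra; $(L,[-,-],d)$ is a differential Lie algebra of weight $\lambda$; $(L,\delta,D)$ is a differential Lie coalgebra of weight $\lambda$; $D$ is adjoint-admissible to $(L,[-,-],d)$; and $d^*$ is adjoint-admissible to the differential Lie algebra $(L^*,\delta^*,D^* )$, where $\langle\delta^*(a^*\otimes b^* ),x\rangle=\langle a^*\otimes b^*,\delta(x)\rangle$. *)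

theory Defs
  imports Complex_Main "HOL-Library.Function_Algebras"
begin

section \<open>Linear algebra on subspaces\<close>

text \<open>
  A vector space over \<open>'k\<close> is a set \<open>V\<close> that is a subspace of an ambient vector space given by
  a type with scalar multiplication \<open>s\<close>.  Carriers are needed because duals and tensor products are
  not types.  Values of maps outside the carrier are irrelevant.
\<close>

definition space_on :: "('k::field \<Rightarrow> 'v::ab_group_add \<Rightarrow> 'v) \<Rightarrow> 'v set \<Rightarrow> bool" where
  "space_on s V \<longleftrightarrow> vector_space s \<and> module.subspace s V"

definition finite_dim_space_on :: "('k::field \<Rightarrow> 'v::ab_group_add \<Rightarrow> 'v) \<Rightarrow> 'v set \<Rightarrow> bool" where
  "finite_dim_space_on s V \<longleftrightarrow> space_on s V \<and> (\<exists>B. finite B \<and> module.span s B = V)"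

definition linear_on ::
  "('k::field \<Rightarrow> 'v::ab_group_add \<Rightarrow> 'v) \<Rightarrow> 'v set \<Rightarrow> ('k \<Rightarrow> 'w::ab_group_add \<Rightarrow> 'w) \<Rightarrow> 'w set \<Rightarrow> ('v \<Rightarrow> 'w) \<Rightarrow> bool"
where
  "linear_on s V t W f \<longleftrightarrow>
     (\<forall>x\<in>V. f x \<in> W) \<and> (\<forall>x\<in>V. \<forall>y\<in>V. f (x + y) = f x + f y) \<and> (\<forall>c. \<forall>x\<in>V. f (s c x) = t c (f x))"

definition bilinear_on ::
  "('k::field \<Rightarrow> 'v::ab_group_add \<Rightarrow> 'v) \<Rightarrow> 'v set \<Rightarrow> ('k \<Rightarrow> 'w::ab_group_add \<Rightarrow> 'w) \<Rightarrow> 'w set \<Rightarrow>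
   ('k \<Rightarrow> 'u::ab_group_add \<Rightarrow> 'u) \<Rightarrow> 'u set \<Rightarrow> ('v \<Rightarrow> 'w \<Rightarrow> 'u) \<Rightarrow> bool"
where
  "bilinear_on s V t W u U B \<longleftrightarrow>
     (\<forall>x\<in>V. linear_on t W u U (B x)) \<and> (\<forall>y\<in>W. linear_on s V u U (\<lambda>x. B x y))"

definition fscale :: "'k::field \<Rightarrow> ('x \<Rightarrow> 'k) \<Rightarrow> 'x \<Rightarrow> 'k" where
  "fscale c f = (\<lambda>x. c * f x)"

text \<open>Functionals vanish outside \<open>V\<close>, so that equal functionals on \<open>V\<close> are equal functions.\<close>

definition dual :: "('k::field \<Rightarrow> 'v::ab_group_add \<Rightarrow> 'v) \<Rightarrow> 'v set \<Rightarrow> ('v \<Rightarrow> 'k) set" where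
  "dual s V = {f. linear_on s V (*) UNIV f \<and> (\<forall>x. x \<notin> V \<longrightarrow> f x = 0)}"

definition transpose_on :: "'v set \<Rightarrow> ('v \<Rightarrow> 'w) \<Rightarrow> ('w \<Rightarrow> 'k::field) \<Rightarrow> 'v \<Rightarrow> 'k" where
  "transpose_on V f b = (\<lambda>x. if x \<in> V then b (f x) else 0)"


section \<open>Tensor products\<close>

text \<open>
  The elementary tensor of \<open>x\<close> and \<open>y\<close> is evaluation of bilinear forms at \<open>(x, y)\<close>, and the
  tensor product is spanned by the elementary tensors (for finite-dimensional spaces this is the
  dual of the space of bilinear forms).  The universal property is proved below.
\<close>

definition tens ::
  "('k::field \<Rightarrow> 'v::ab_group_add \<Rightarrow> 'v) \<Rightarrow> 'v set \<Rightarrow> ('k \<Rightarrow> 'w::ab_group_add \<Rightarrow> 'w) \<Rightarrow> 'w set \<Rightarrow>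
   'v \<Rightarrow> 'w \<Rightarrow> ('v \<Rightarrow> 'w \<Rightarrow> 'k) \<Rightarrow> 'k"
where
  "tens s V t W x y = (\<lambda>\<beta>. if bilinear_on s V t W (*) UNIV \<beta> then \<beta> x y else 0)"

definition tensor_space ::
  "('k::field \<Rightarrow> 'v::ab_group_add \<Rightarrow> 'v) \<Rightarrow> 'v set \<Rightarrow> ('k \<Rightarrow> 'w::ab_group_add \<Rightarrow> 'w) \<Rightarrow> 'w set \<Rightarrow>
   (('v \<Rightarrow> 'w \<Rightarrow> 'k) \<Rightarrow> 'k) set"
where
  "tensor_space s V t W = module.span fscale {tens s V t W x y | x y. x \<in> V \<and> y \<in> W}"

text \<open>
  \<open>lift B\<close> is the linear map with \<open>x \<otimes> y \<mapsto> B x y\<close>, for bilinear \<open>B\<close> with values in a space of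
  \<open>'k\<close>-valued functions; so \<open>lift B r\<close> renders the Sweedler-style expression \<open>B r\<^sub>1 r\<^sub>2\<close>.
\<close>

definition lift :: "('v \<Rightarrow> 'w \<Rightarrow> 'z \<Rightarrow> 'k) \<Rightarrow> (('v \<Rightarrow> 'w \<Rightarrow> 'k) \<Rightarrow> 'k) \<Rightarrow> 'z \<Rightarrow> 'k" where
  "lift B t = (\<lambda>z. t (\<lambda>x y. B x y z))"

text \<open>The pairing of \<open>a \<otimes> b\<close> with \<open>t\<close>, for functionals \<open>a\<close>, \<open>b\<close>; it sends \<open>x \<otimes> y\<close> to \<open>a x * b y\<close>.\<close>

definition tensor_pair ::
  "('v \<Rightarrow> 'k::field) \<Rightarrow> ('w \<Rightarrow> 'k) \<Rightarrow> (('v \<Rightarrow> 'w \<Rightarrow> 'k) \<Rightarrow> 'k) \<Rightarrow> 'k"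
where
  "tensor_pair a b t = t (\<lambda>x y. a x * b y)"

interpretation fscale: vector_space "fscale :: 'k::field \<Rightarrow> ('x \<Rightarrow> 'k) \<Rightarrow> 'x \<Rightarrow> 'k"
  by unfold_locales (auto simp: fscale_def fun_eq_iff algebra_simps)

lemma space_on_tensor_space: "space_on fscale (tensor_space s V t W)"
  unfolding space_on_def tensor_space_def
  using fscale.vector_space_axioms fscale.subspace_span by blast

lemma bilinear_on_tens:
  assumes "space_on s V" "space_on t W"
  shows "bilinear_on s V t W fscale (tensor_space s V t W) (tens s V t W)"
  unfolding bilinear_on_def linear_on_def tensor_space_def
  by (auto intro!: fscale.span_base)
     (auto simp: tens_def fscale_def fun_eq_iff bilinear_on_def linear_on_def)

lemma lift_tens:
  assumes "bilinear_on s V t W fscale U B" "x \<in> V" "y \<in> W"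
  shows "lift B (tens s V t W x y) = B x y"
proof
  fix z
  have "bilinear_on s V t W (*) UNIV (\<lambda>x y. B x y z)"
    using assms(1) by (auto simp: bilinear_on_def linear_on_def fscale_def fun_eq_iff)
  then show "lift B (tens s V t W x y) z = B x y z"
    by (simp add: lift_def tens_def)
qed

lemma linear_on_lift:
  assumes "bilinear_on s V t W fscale U B" "fscale.subspace U"
  shows "linear_on fscale (tensor_space s V t W) fscale U (lift B)"
proof -
  have add: "lift B (x + y) = lift B x + lift B y" for x y
    by (simp add: lift_def fun_eq_iff)
  have scale: "lift B (fscale c x) = fscale c (lift B x)" for c x
    by (simp add: lift_def fscale_def fun_eq_iff)
  have "lift B u \<in> U" if "u \<in> tensor_space s V t W" for u
    using that unfolding tensor_space_def
  proof (induction rule: fscale.span_induct_alt)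
    case base
    have "lift B 0 = 0" by (simp add: lift_def fun_eq_iff)
    then show ?case using assms(2) fscale.subspace_0 by metis
  next
    case (step c x y)
    then obtain a b where ab: "x = tens s V t W a b" "a \<in> V" "b \<in> W" by blast
    have "lift B x \<in> U"
      using ab assms(1) lift_tens[OF assms(1)] by (auto simp: bilinear_on_def linear_on_def)
    then show ?case
      unfolding add scale using step assms(2) fscale.subspace_add fscale.subspace_scale by blast
  qed
  then show ?thesis by (auto simp: linear_on_def add scale)
qed

lemma lift_unique:
  fixes f :: "(('v::ab_group_add \<Rightarrow> 'w::ab_group_add \<Rightarrow> 'k::field) \<Rightarrow> 'k) \<Rightarrow> 'z \<Rightarrow> 'k"
  assumes B: "bilinear_on s V t W fscale U B" "fscale.subspace U"
    and f: "linear_on fscale (tensor_space s V t W) fscale U f"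
    and eq: "\<And>x y. x \<in> V \<Longrightarrow> y \<in> W \<Longrightarrow> f (tens s V t W x y) = B x y"
    and u: "u \<in> tensor_space s V t W"
  shows "f u = lift B u"
proof -
  let ?S = "{tens s V t W x y | x y. x \<in> V \<and> y \<in> W}"
  have g: "linear_on fscale (tensor_space s V t W) fscale U (lift B)"
    using linear_on_lift[OF B] .
  have z: "0 \<in> tensor_space s V t W"
    by (simp add: tensor_space_def fscale.span_zero)
  from f z have "f (0 + 0) = f 0 + f 0" unfolding linear_on_def by blast
  then have f0: "f 0 = 0" by (simp only: add_0 add_cancel_right_right)
  have "u \<in> fscale.span ?S" using u by (simp add: tensor_space_def)
  then have "f u = lift B u \<and> u \<in> tensor_space s V t W"
  proof (induction rule: fscale.span_induct_alt)
    case base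
    have "lift B 0 = 0" by (simp add: lift_def fun_eq_iff)
    then show ?case using f0 z by metis
  next
    case (step c x y)
    then obtain a b where ab: "x = tens s V t W a b" "a \<in> V" "b \<in> W" by blast
    have x: "x \<in> tensor_space s V t W"
      using step unfolding tensor_space_def by (blast intro: fscale.span_base)
    have cx: "fscale c x \<in> tensor_space s V t W"
      using x unfolding tensor_space_def by (rule fscale.span_scale)
    have "f x = lift B x" using ab eq lift_tens[OF B(1)] by simp
    then have "f (fscale c x + y) = lift B (fscale c x + y)"
      using f g x cx step unfolding linear_on_def by simp
    moreover have "fscale c x + y \<in> tensor_space s V t W"
      using cx step unfolding tensor_space_def by (blast intro: fscale.span_add)
    ultimately show ?case by (rule conjI)
  qed
  then show ?thesis by simp
qed

subsection \<open>Tensor powers of a single space\<close>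

abbreviation tens2 where
  "tens2 s L x y \<equiv> tens s L s L x y"

abbreviation tensor2 where
  "tensor2 s L \<equiv> tensor_space s L s L"

text \<open>The triple tensor product is taken as \<open>(L \<otimes> L) \<otimes> L\<close>.\<close>

abbreviation tens3 where
  "tens3 s L x y z \<equiv> tens fscale (tensor2 s L) s L (tens2 s L x y) z"

definition tensor_map ::
  "('k::field \<Rightarrow> 'a::ab_group_add \<Rightarrow> 'a) \<Rightarrow> 'a set \<Rightarrow> ('a \<Rightarrow> 'a) \<Rightarrow> ('a \<Rightarrow> 'a) \<Rightarrow>
   (('a \<Rightarrow> 'a \<Rightarrow> 'k) \<Rightarrow> 'k) \<Rightarrow> ('a \<Rightarrow> 'a \<Rightarrow> 'k) \<Rightarrow> 'k"
where
  "tensor_map s L f g = lift (\<lambda>x y. tens2 s L (f x) (g y))"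

definition flip ::
  "('k::field \<Rightarrow> 'a::ab_group_add \<Rightarrow> 'a) \<Rightarrow> 'a set \<Rightarrow> (('a \<Rightarrow> 'a \<Rightarrow> 'k) \<Rightarrow> 'k) \<Rightarrow> ('a \<Rightarrow> 'a \<Rightarrow> 'k) \<Rightarrow> 'k"
where
  "flip s L = lift (\<lambda>x y. tens2 s L y x)"

definition cycle3 ::
  "('k::field \<Rightarrow> 'a::ab_group_add \<Rightarrow> 'a) \<Rightarrow> 'a set \<Rightarrow>
   (((('a \<Rightarrow> 'a \<Rightarrow> 'k) \<Rightarrow> 'k) \<Rightarrow> 'a \<Rightarrow> 'k) \<Rightarrow> 'k) \<Rightarrow> ((('a \<Rightarrow> 'a \<Rightarrow> 'k) \<Rightarrow> 'k) \<Rightarrow> 'a \<Rightarrow> 'k) \<Rightarrow> 'k"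
where \<comment> \<open>\<open>x \<otimes> y \<otimes> z \<mapsto> y \<otimes> z \<otimes> x\<close>\<close>
  "cycle3 s L = lift (\<lambda>t z. lift (\<lambda>x y. tens3 s L y z x) t)"


section \<open>Differential Lie algebras\<close>

definition lie_algebra ::
  "('k::field \<Rightarrow> 'a::ab_group_add \<Rightarrow> 'a) \<Rightarrow> 'a set \<Rightarrow> ('a \<Rightarrow> 'a \<Rightarrow> 'a) \<Rightarrow> bool"
where
  "lie_algebra s L br \<longleftrightarrow> space_on s L \<and> bilinear_on s L s L s L br \<and>
     (\<forall>x\<in>L. br x x = 0) \<and>
     (\<forall>x\<in>L. \<forall>y\<in>L. \<forall>z\<in>L. br x (br y z) + br y (br z x) + br z (br x y) = 0)"

definition diff_lie_algebra ::
  "'k \<Rightarrow> ('k::field \<Rightarrow> 'a::ab_group_add \<Rightarrow> 'a) \<Rightarrow> 'a set \<Rightarrow> ('a \<Rightarrow> 'a \<Rightarrow> 'a) \<Rightarrow> ('a \<Rightarrow> 'a) \<Rightarrow> bool"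
where
  "diff_lie_algebra lam s L br d \<longleftrightarrow> lie_algebra s L br \<and> linear_on s L s L d \<and>
     (\<forall>x\<in>L. \<forall>y\<in>L. d (br x y) = br (d x) y + br x (d y) + s lam (br (d x) (d y)))"

definition lie_representation ::
  "('k::field \<Rightarrow> 'a::ab_group_add \<Rightarrow> 'a) \<Rightarrow> 'a set \<Rightarrow> ('a \<Rightarrow> 'a \<Rightarrow> 'a) \<Rightarrow>
   ('k \<Rightarrow> 'v::ab_group_add \<Rightarrow> 'v) \<Rightarrow> 'v set \<Rightarrow> ('a \<Rightarrow> 'v \<Rightarrow> 'v) \<Rightarrow> bool"
where
  "lie_representation s L br t V \<rho> \<longleftrightarrow> lie_algebra s L br \<and> space_on t V \<and>
     bilinear_on s L t V t V \<rho> \<and>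
     (\<forall>x\<in>L. \<forall>y\<in>L. \<forall>v\<in>V. \<rho> (br x y) v = \<rho> x (\<rho> y v) - \<rho> y (\<rho> x v))"

definition diff_lie_representation ::
  "'k \<Rightarrow> ('k::field \<Rightarrow> 'a::ab_group_add \<Rightarrow> 'a) \<Rightarrow> 'a set \<Rightarrow> ('a \<Rightarrow> 'a \<Rightarrow> 'a) \<Rightarrow> ('a \<Rightarrow> 'a) \<Rightarrow>
   ('k \<Rightarrow> 'v::ab_group_add \<Rightarrow> 'v) \<Rightarrow> 'v set \<Rightarrow> ('a \<Rightarrow> 'v \<Rightarrow> 'v) \<Rightarrow> ('v \<Rightarrow> 'v) \<Rightarrow> bool"
where
  "diff_lie_representation lam s L br d t V \<rho> \<xi> \<longleftrightarrow>
     diff_lie_algebra lam s L br d \<and> lie_representation s L br t V \<rho> \<and> linear_on t V t V \<xi> \<and>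
     (\<forall>x\<in>L. \<forall>v\<in>V. \<xi> (\<rho> x v) = \<rho> (d x) v + \<rho> x (\<xi> v) + t lam (\<rho> (d x) (\<xi> v)))"

definition coadjoint :: "'a set \<Rightarrow> ('a \<Rightarrow> 'a \<Rightarrow> 'a) \<Rightarrow> 'a \<Rightarrow> ('a \<Rightarrow> 'k::field) \<Rightarrow> 'a \<Rightarrow> 'k" where
  "coadjoint L br x b = (\<lambda>y. if y \<in> L then - b (br x y) else 0)"

definition adjoint_admissible ::
  "'k \<Rightarrow> ('k::field \<Rightarrow> 'a::ab_group_add \<Rightarrow> 'a) \<Rightarrow> 'a set \<Rightarrow> ('a \<Rightarrow> 'a \<Rightarrow> 'a) \<Rightarrow> ('a \<Rightarrow> 'a) \<Rightarrow> ('a \<Rightarrow> 'a) \<Rightarrow> bool"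
where
  "adjoint_admissible lam s L br d p \<longleftrightarrow> linear_on s L s L p \<and>
     diff_lie_representation lam s L br d fscale (dual s L) (coadjoint L br) (transpose_on L p)"


section \<open>Differential Lie coalgebras and bialgebras\<close>

text \<open>
  Co-antisymmetry is the dual of \<open>[x, x] = 0\<close>: the image of \<open>\<delta>\<close> lies in the image of \<open>id - \<tau>\<close>.
  In characteristic other than 2 this is \<open>\<delta> = - \<tau> \<circ> \<delta>\<close>; in characteristic 2 the latter
  would not make the dual bracket alternating.  The co-Jacobi identity is
  \<open>(id + \<sigma> + \<sigma>\<^sup>2) (\<delta> \<otimes> id) \<delta> = 0\<close>, where \<open>\<sigma>\<close> is \<^const>\<open>cycle3\<close>.
\<close>

definition lie_coalgebra ::
  "('k::field \<Rightarrow> 'a::ab_group_add \<Rightarrow> 'a) \<Rightarrow> 'a set \<Rightarrow> ('a \<Rightarrow> ('a \<Rightarrow> 'a \<Rightarrow> 'k) \<Rightarrow> 'k) \<Rightarrow> bool"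
where
  "lie_coalgebra s L \<delta> \<longleftrightarrow> space_on s L \<and> linear_on s L fscale (tensor2 s L) \<delta> \<and>
     (\<forall>x\<in>L. \<exists>u\<in>tensor2 s L. \<delta> x = u - flip s L u) \<and>
     (\<forall>x\<in>L. let w = lift (\<lambda>y z. tens fscale (tensor2 s L) s L (\<delta> y) z) (\<delta> x)
             in w + cycle3 s L w + cycle3 s L (cycle3 s L w) = 0)"

definition diff_lie_coalgebra ::
  "'k \<Rightarrow> ('k::field \<Rightarrow> 'a::ab_group_add \<Rightarrow> 'a) \<Rightarrow> 'a set \<Rightarrow>
   ('a \<Rightarrow> ('a \<Rightarrow> 'a \<Rightarrow> 'k) \<Rightarrow> 'k) \<Rightarrow> ('a \<Rightarrow> 'a) \<Rightarrow> bool"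
where
  "diff_lie_coalgebra lam s L \<delta> D \<longleftrightarrow> lie_coalgebra s L \<delta> \<and> linear_on s L s L D \<and>
     (\<forall>x\<in>L. \<delta> (D x) = tensor_map s L D id (\<delta> x) + tensor_map s L id D (\<delta> x)
                       + fscale lam (tensor_map s L D D (\<delta> x)))"

definition ad2 ::
  "('k::field \<Rightarrow> 'a::ab_group_add \<Rightarrow> 'a) \<Rightarrow> 'a set \<Rightarrow> ('a \<Rightarrow> 'a \<Rightarrow> 'a) \<Rightarrow> 'a \<Rightarrow>
   (('a \<Rightarrow> 'a \<Rightarrow> 'k) \<Rightarrow> 'k) \<Rightarrow> ('a \<Rightarrow> 'a \<Rightarrow> 'k) \<Rightarrow> 'k"
where
  "ad2 s L br x t = tensor_map s L (br x) id t + tensor_map s L id (br x) t"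

definition lie_bialgebra ::
  "('k::field \<Rightarrow> 'a::ab_group_add \<Rightarrow> 'a) \<Rightarrow> 'a set \<Rightarrow> ('a \<Rightarrow> 'a \<Rightarrow> 'a) \<Rightarrow>
   ('a \<Rightarrow> ('a \<Rightarrow> 'a \<Rightarrow> 'k) \<Rightarrow> 'k) \<Rightarrow> bool"
where
  "lie_bialgebra s L br \<delta> \<longleftrightarrow> lie_algebra s L br \<and> lie_coalgebra s L \<delta> \<and>
     (\<forall>x\<in>L. \<forall>y\<in>L. \<delta> (br x y) = ad2 s L br x (\<delta> y) - ad2 s L br y (\<delta> x))"

definition dual_bracket ::
  "'a set \<Rightarrow> ('a \<Rightarrow> ('a \<Rightarrow> 'a \<Rightarrow> 'k) \<Rightarrow> 'k) \<Rightarrow> ('a \<Rightarrow> 'k::field) \<Rightarrow> ('a \<Rightarrow> 'k) \<Rightarrow> 'a \<Rightarrow> 'k"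
where
  "dual_bracket L \<delta> a b = (\<lambda>x. if x \<in> L then tensor_pair a b (\<delta> x) else 0)"

definition diff_lie_bialgebra ::
  "'k \<Rightarrow> ('k::field \<Rightarrow> 'a::ab_group_add \<Rightarrow> 'a) \<Rightarrow> 'a set \<Rightarrow> ('a \<Rightarrow> 'a \<Rightarrow> 'a) \<Rightarrow> ('a \<Rightarrow> 'a) \<Rightarrow>
   ('a \<Rightarrow> ('a \<Rightarrow> 'a \<Rightarrow> 'k) \<Rightarrow> 'k) \<Rightarrow> ('a \<Rightarrow> 'a) \<Rightarrow> bool"
where
  "diff_lie_bialgebra lam s L br d \<delta> D \<longleftrightarrow>
     lie_bialgebra s L br \<delta> \<and> diff_lie_algebra lam s L br d \<and> diff_lie_coalgebra lam s L \<delta> D \<and>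
     adjoint_admissible lam s L br d D \<and>
     adjoint_admissible lam fscale (dual s L) (dual_bracket L \<delta>) (transpose_on L D) (transpose_on L d)"


section \<open>The classical Yang-Baxter equation\<close>

definition CYB ::
  "('k::field \<Rightarrow> 'a::ab_group_add \<Rightarrow> 'a) \<Rightarrow> 'a set \<Rightarrow> ('a \<Rightarrow> 'a \<Rightarrow> 'a) \<Rightarrow>
   (('a \<Rightarrow> 'a \<Rightarrow> 'k) \<Rightarrow> 'k) \<Rightarrow> ((('a \<Rightarrow> 'a \<Rightarrow> 'k) \<Rightarrow> 'k) \<Rightarrow> 'a \<Rightarrow> 'k) \<Rightarrow> 'k"
where
  "CYB s L br r =
     lift (\<lambda>r1 r2. lift (\<lambda>q1 q2. tens3 s L (br r1 q1) r2 q2 + tens3 s L r1 q1 (br r2 q2)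
                                  + tens3 s L r1 (br r2 q1) q2) r) r"

definition diff_CYBE_solution ::
  "('k::field \<Rightarrow> 'a::ab_group_add \<Rightarrow> 'a) \<Rightarrow> 'a set \<Rightarrow> ('a \<Rightarrow> 'a \<Rightarrow> 'a) \<Rightarrow> ('a \<Rightarrow> 'a) \<Rightarrow> ('a \<Rightarrow> 'a) \<Rightarrow>
   (('a \<Rightarrow> 'a \<Rightarrow> 'k) \<Rightarrow> 'k) \<Rightarrow> bool"
where
  "diff_CYBE_solution s L br d D r \<longleftrightarrow>
     CYB s L br r = 0 \<and> tensor_map s L D id r - tensor_map s L id d r = 0"

definition delta_r ::
  "('k::field \<Rightarrow> 'a::ab_group_add \<Rightarrow> 'a) \<Rightarrow> 'a set \<Rightarrow> ('a \<Rightarrow> 'a \<Rightarrow> 'a) \<Rightarrow>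
   (('a \<Rightarrow> 'a \<Rightarrow> 'k) \<Rightarrow> 'k) \<Rightarrow> 'a \<Rightarrow> ('a \<Rightarrow> 'a \<Rightarrow> 'k) \<Rightarrow> 'k"
where
  "delta_r s L br r x = ad2 s L br x r"

end

theory Submission
  imports Defs
begin

text \<open>
  An element of a tensor product is a functional on bilinear forms that vanishes at all other
  arguments, so two tensors are equal as soon as they agree at every bilinear form
  (\<open>tensor_eqI\<close>).  Writing \<open>r\<close> as a finite sum of elementary tensors \<open>a \<otimes> b\<close>, every condition on the
  bialgebra becomes an identity between finite sums of values of bilinear or trilinear forms.
  With \<open>r = a \<otimes> b\<close> (summation suppressed), \<open>\<delta> x = [x,a] \<otimes> b + a \<otimes> [x,b]\<close>.

  The Lie bialgebra part is Drinfeld's: a coboundary is a cocycle; skew-symmetry of \<open>r\<close> gives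
  \<open>\<delta> x = t - \<tau> t\<close> with \<open>t = [x,a] \<otimes> b\<close>; and the co-Jacobi expression at \<open>x\<close> equals \<open>- x \<cdot> CYB r\<close>
  (\<open>delta_co_jacobi\<close>).

  For the differential part, let \<open>(D \<otimes> id) r = (id \<otimes> d) r\<close>.  By skew-symmetry also
  \<open>(d \<otimes> id) r = (id \<otimes> D) r\<close>, so that an operator \<open>d\<close> on one leg of \<open>r\<close> can be traded for \<open>D\<close> on the other.
  Admissibility \<open>[x, D y] = [d x, y] + D [x, y] + \<lambda> D [d x, y]\<close> expands the bracket of \<open>x\<close> with a leg carrying
  \<open>D\<close>, and the bracket of \<open>D x\<close> with any leg.  Together these give the coderivation property of \<open>D\<close>
  (\<open>delta_D\<close>) and
  \<open>(id \<otimes> d) (\<delta> x) = (D \<otimes> id) (\<delta> x) + \<delta> (d x) + \<lambda> (D \<otimes> id) (\<delta> (d x))\<close> (\<open>delta_d\<close>).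

  The conditions on the dual space are formal consequences: the dual of a differential Lie
  coalgebra is a differential Lie algebra (\<open>dual_diff_lie_algebra\<close>), its coadjoint action is a
  representation as for any Lie algebra, and admissibility of \<open>d\<^sup>*\<close> reduces to the transpose of
  \<open>delta_d\<close> (\<open>adjoint_admissible_iff\<close>).
\<close>

section \<open>Multilinear forms and tensors\<close>

abbreviation bilin where
  "bilin s L \<equiv> bilinear_on s L s L (*) UNIV"

definition trilin ::
  "('k::field \<Rightarrow> 'a::ab_group_add \<Rightarrow> 'a) \<Rightarrow> 'a set \<Rightarrow> ('a \<Rightarrow> 'a \<Rightarrow> 'a \<Rightarrow> 'k) \<Rightarrow> bool"
where
  "trilin s L g \<longleftrightarrow> (\<forall>z\<in>L. bilin s L (\<lambda>x y. g x y z)) \<and>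
     (\<forall>x\<in>L. \<forall>y\<in>L. linear_on s L (*) UNIV (g x y))"

definition rot :: "('a \<Rightarrow> 'a \<Rightarrow> 'a \<Rightarrow> 'k) \<Rightarrow> 'a \<Rightarrow> 'a \<Rightarrow> 'a \<Rightarrow> 'k" where
  "rot g = (\<lambda>x y z. g y z x)"

lemma trilin_rot: "trilin s L g \<Longrightarrow> trilin s L (rot g)"
  by (auto simp: trilin_def rot_def bilinear_on_def linear_on_def)

lemma space_on_closed:
  assumes "space_on s V"
  shows "0 \<in> V" "x \<in> V \<Longrightarrow> y \<in> V \<Longrightarrow> x + y \<in> V" "x \<in> V \<Longrightarrow> s c x \<in> V"
    "x \<in> V \<Longrightarrow> - x \<in> V" "x \<in> V \<Longrightarrow> y \<in> V \<Longrightarrow> x - y \<in> V"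
proof -
  have m: "module s" and S: "module.subspace s V"
    using assms by (auto simp: space_on_def module_iff_vector_space)
  show "0 \<in> V" "x \<in> V \<Longrightarrow> y \<in> V \<Longrightarrow> x + y \<in> V" "x \<in> V \<Longrightarrow> s c x \<in> V"
    "x \<in> V \<Longrightarrow> - x \<in> V" "x \<in> V \<Longrightarrow> y \<in> V \<Longrightarrow> x - y \<in> V"
    using module.subspace_0[OF m S] module.subspace_add[OF m S] module.subspace_scale[OF m S]
      module.subspace_neg[OF m S] module.subspace_diff[OF m S] by auto
qed

lemma bilinear_on_cong:
  assumes "\<And>x y. x \<in> V \<Longrightarrow> y \<in> W \<Longrightarrow> b x y = c x y" "space_on s V" "space_on t W"
  shows "bilinear_on s V t W u U b \<longleftrightarrow> bilinear_on s V t W u U c"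
  using space_on_closed[OF assms(2)] space_on_closed[OF assms(3)]
  unfolding bilinear_on_def linear_on_def by (simp add: assms(1))

lemma linear_on_simps:
  assumes "linear_on s V t W f" "space_on s V"
  shows "f 0 = 0" "x \<in> V \<Longrightarrow> f (- x) = - f x" "x \<in> V \<Longrightarrow> y \<in> V \<Longrightarrow> f (x - y) = f x - f y"
proof -
  note cl = space_on_closed[OF assms(2)]
  have add: "f (x + y) = f x + f y" if "x \<in> V" "y \<in> V" for x y
    using assms(1) that by (auto simp: linear_on_def)
  show 0: "f 0 = 0" using add[OF cl(1,1)] by simp
  show "f (- x) = - f x" if "x \<in> V" for x
    using add[of x "- x"] that cl 0 by (simp add: eq_neg_iff_add_eq_0 add.commute)
  then show "f (x - y) = f x - f y" if "x \<in> V" "y \<in> V" for x y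
    using add[of x "- y"] that cl by simp
qed

lemma alternating_antisym:
  assumes "space_on s V" "bilinear_on s V s V u U b" "\<And>x. x \<in> V \<Longrightarrow> b x x = 0"
    and x: "x \<in> V" "y \<in> V"
  shows "b y x = - b x y"
proof -
  have xy: "x + y \<in> V" using assms(1) x by (rule space_on_closed)
  have "b (x + y) (x + y) = b x (x + y) + b y (x + y)"
    using assms(2) x xy unfolding bilinear_on_def linear_on_def by blast
  also have "\<dots> = (b x x + b x y) + (b y x + b y y)"
    using assms(2) x unfolding bilinear_on_def linear_on_def by metis
  finally have "b x y + b y x = 0"
    using assms(3) x xy by simp
  then show ?thesis by (simp add: eq_neg_iff_add_eq_0 add.commute)
qed

text \<open>
  Scalars are absorbed into the first factor, which is why a finite sum of elementary tensors
  suffices.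
\<close>

lemma tensor_space_sum:
  assumes "t \<in> tensor_space s V s' W" "space_on s V"
  obtains n x y where "\<And>i. i < n \<Longrightarrow> x (i::nat) \<in> V" "\<And>i. i < n \<Longrightarrow> y i \<in> W"
    "\<And>\<beta>. t \<beta> = (if bilinear_on s V s' W (*) UNIV \<beta> then \<Sum>i<n. \<beta> (x i) (y i) else 0)"
proof -
  let ?R = "\<lambda>t n x y. (\<forall>i<n. x (i::nat) \<in> V) \<and> (\<forall>i<n. y i \<in> W) \<and>
    (\<forall>\<beta>. t \<beta> = (if bilinear_on s V s' W (*) UNIV \<beta> then \<Sum>i<n. \<beta> (x i) (y i) else 0))"
  have "\<exists>n x y. ?R t n x y"
    using assms(1) unfolding tensor_space_def
  proof (induction rule: fscale.span_induct_alt)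
    case base
    show ?case
      by (intro exI[of _ 0]) auto
  next
    case (step c e t)
    then obtain p q where e: "e = tens s V s' W p q" "p \<in> V" "q \<in> W" by blast
    from step obtain n x y where R: "?R t n x y" by blast
    have "?R (fscale c e + t) (Suc n) (x(n := s c p)) (y(n := q))"
    proof (intro conjI allI impI)
      fix \<beta>
      have "bilinear_on s V s' W (*) UNIV \<beta> \<Longrightarrow> \<beta> (s c p) q = c * \<beta> p q"
        using e by (simp add: bilinear_on_def linear_on_def)
      then show "(fscale c e + t) \<beta> = (if bilinear_on s V s' W (*) UNIV \<beta>
          then \<Sum>i<Suc n. \<beta> ((x(n := s c p)) i) ((y(n := q)) i) else 0)"
        using R e by (simp add: fscale_def tens_def)
    qed (use R e space_on_closed[OF assms(2)] in \<open>auto simp: less_Suc_eq\<close>)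
    then show ?case by blast
  qed
  then show ?thesis using that by blast
qed

lemma tensor_not_bilinear:
  assumes "t \<in> tensor_space s V s' W" "space_on s V" "\<not> bilinear_on s V s' W (*) UNIV \<beta>"
  shows "t \<beta> = 0"
  using assms by (auto elim!: tensor_space_sum)

lemma tensor_eqI:
  assumes "t \<in> tensor_space s V s' W" "u \<in> tensor_space s V s' W" "space_on s V"
    and "\<And>\<beta>. bilinear_on s V s' W (*) UNIV \<beta> \<Longrightarrow> t \<beta> = u \<beta>"
  shows "t = u"
  using tensor_not_bilinear[OF assms(1,3)] tensor_not_bilinear[OF assms(2,3)] assms(4)
  by (metis ext)

lemma tensor_cong:
  assumes t: "t \<in> tensor_space s V s' W" and sp: "space_on s V" "space_on s' W"
    and "\<And>x y. x \<in> V \<Longrightarrow> y \<in> W \<Longrightarrow> \<beta> x y = \<beta>' x y"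
  shows "t \<beta> = t \<beta>'"
proof (rule tensor_space_sum[OF t sp(1)])
  fix n x y
  assume "\<And>i. i < n \<Longrightarrow> x (i::nat) \<in> V" "\<And>i. i < n \<Longrightarrow> y i \<in> W"
    "\<And>\<beta>. t \<beta> = (if bilinear_on s V s' W (*) UNIV \<beta> then \<Sum>i<n. \<beta> (x i) (y i) else 0)"
  moreover have "bilinear_on s V s' W (*) UNIV \<beta> \<longleftrightarrow> bilinear_on s V s' W (*) UNIV \<beta>'"
    by (rule bilinear_on_cong[OF _ sp]) (rule assms(4))
  ultimately show "t \<beta> = t \<beta>'" by (simp add: assms(4))
qed

lemma tensor_add:
  assumes "t \<in> tensor_space s V s' W" "space_on s V"
    and "bilinear_on s V s' W (*) UNIV \<beta>" "bilinear_on s V s' W (*) UNIV \<beta>'"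
  shows "t (\<lambda>x y. \<beta> x y + \<beta>' x y) = t \<beta> + t \<beta>'"
proof -
  have "bilinear_on s V s' W (*) UNIV (\<lambda>x y. \<beta> x y + \<beta>' x y)"
    using assms(3,4) by (auto simp: bilinear_on_def linear_on_def algebra_simps)
  then show ?thesis
    using assms(3,4) by (rule_tac tensor_space_sum[OF assms(1,2)]) (auto simp: sum.distrib)
qed

lemma tensor_scale:
  assumes "t \<in> tensor_space s V s' W" "space_on s V" "bilinear_on s V s' W (*) UNIV \<beta>"
  shows "t (\<lambda>x y. c * \<beta> x y) = c * t \<beta>"
proof -
  have "bilinear_on s V s' W (*) UNIV (\<lambda>x y. c * \<beta> x y)"
    using assms(3) by (auto simp: bilinear_on_def linear_on_def algebra_simps)
  then show ?thesis
    using assms(3) by (rule_tac tensor_space_sum[OF assms(1,2)]) (auto simp: sum_distrib_left)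
qed

text \<open>
  The uniqueness half of the universal property, for scalar-valued linear maps.
\<close>

lemma linear_form_tensor:
  assumes f: "linear_on fscale (tensor_space s V s' W) (*) UNIV f"
    and t: "t \<in> tensor_space s V s' W" and sp: "space_on s V" "space_on s' W"
  shows "f t = t (\<lambda>x y. f (tens s V s' W x y))"
proof -
  let ?B = "\<lambda>x y (_::unit). f (tens s V s' W x y)"
  have tn: "bilinear_on s V s' W fscale (tensor_space s V s' W) (tens s V s' W)"
    using sp by (rule bilinear_on_tens)
  have B: "bilinear_on s V s' W fscale UNIV ?B"
    using tn f by (simp add: bilinear_on_def linear_on_def)
       (simp add: fscale_def fun_eq_iff[where 'a=unit])
  have "(\<lambda>_::unit. f t) = lift ?B t"
  proof (rule lift_unique[OF B _ _ _ t])
    show "linear_on fscale (tensor_space s V s' W) fscale UNIV (\<lambda>t _. f t)"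
      using f by (auto simp: linear_on_def fscale_def fun_eq_iff)
  qed (auto simp: fscale.subspace_UNIV)
  then show ?thesis by (simp add: lift_def fun_eq_iff)
qed

lemma tensor_map_apply:
  "bilin s L \<beta> \<Longrightarrow> tensor_map s L f g t \<beta> = t (\<lambda>x y. \<beta> (f x) (g y))"
  by (simp add: tensor_map_def lift_def tens_def)

lemma flip_apply: "bilin s L \<beta> \<Longrightarrow> flip s L t \<beta> = t (\<lambda>x y. \<beta> y x)"
  by (simp add: flip_def lift_def tens_def)

lemma tensor_map_in_tensor2:
  assumes "space_on s L" "linear_on s L s L f" "linear_on s L s L g" "t \<in> tensor2 s L"
  shows "tensor_map s L f g t \<in> tensor2 s L"
proof -
  have "bilinear_on s L s L fscale (tensor2 s L) (\<lambda>x y. tens2 s L (f x) (g y))"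
    using bilinear_on_tens[OF assms(1,1)] assms(2,3) by (auto simp: bilinear_on_def linear_on_def)
  from linear_on_lift[OF this] assms(4) show ?thesis
    unfolding tensor_map_def linear_on_def tensor_space_def using fscale.subspace_span by blast
qed

lemma trilin_slice:
  assumes "trilin s L g" "t \<in> tensor2 s L" "space_on s L"
  shows "linear_on s L (*) UNIV (\<lambda>z. t (\<lambda>x y. g x y z))"
proof -
  have b: "bilin s L (\<lambda>x y. g x y z)" if "z \<in> L" for z
    using assms(1) that by (auto simp: trilin_def)
  show ?thesis
    unfolding linear_on_def
  proof (intro conjI ballI allI)
    fix z z' c assume z: "z \<in> L" "z' \<in> L"
    have "t (\<lambda>x y. g x y (z + z')) = t (\<lambda>x y. g x y z + g x y z')"
      using assms(1) z by (intro tensor_cong[OF assms(2,3,3)]) (auto simp: trilin_def linear_on_def)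
    also have "\<dots> = t (\<lambda>x y. g x y z) + t (\<lambda>x y. g x y z')"
      using z by (intro tensor_add[OF assms(2,3)] b)
    finally show "t (\<lambda>x y. g x y (z + z')) = t (\<lambda>x y. g x y z) + t (\<lambda>x y. g x y z')" .
  next
    fix z c assume z: "z \<in> L"
    have "t (\<lambda>x y. g x y (s c z)) = t (\<lambda>x y. c * g x y z)"
      using assms(1) z by (intro tensor_cong[OF assms(2,3,3)]) (auto simp: trilin_def linear_on_def)
    also have "\<dots> = c * t (\<lambda>x y. g x y z)"
      using z by (intro tensor_scale[OF assms(2,3)] b)
    finally show "t (\<lambda>x y. g x y (s c z)) = c * t (\<lambda>x y. g x y z)" .
  qed auto
qed

text \<open>
  A trilinear form on \<open>L\<close> is the same as a bilinear form on \<open>(L \<otimes> L) \<times> L\<close>: this lemma gives one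
  direction, \<open>trilin_tens3\<close> the other, and \<open>tens3_curry\<close> says that they match.  Hence tensors in
  \<open>(L \<otimes> L) \<otimes> L\<close> may be tested on trilinear forms.
\<close>

lemma trilin_curry:
  assumes "trilin s L g" "space_on s L"
  shows "bilinear_on fscale (tensor2 s L) s L (*) UNIV (\<lambda>t z. t (\<lambda>x y. g x y z))"
  using trilin_slice[OF assms(1) _ assms(2)]
  by (auto simp: bilinear_on_def) (auto simp: linear_on_def fscale_def)

lemma trilin_tens3:
  assumes "space_on s L"
  shows "trilin s L (\<lambda>x y z. tens3 s L x y z G)"
  using bilinear_on_tens[OF assms assms] bilinear_on_tens[OF space_on_tensor_space[of s L s L] assms]
  by (auto simp: trilin_def bilinear_on_def linear_on_def fscale_def)

lemma tens3_curry:
  assumes "trilin s L g" "space_on s L" "z \<in> L"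
  shows "tens3 s L x y z (\<lambda>t z. t (\<lambda>x y. g x y z)) = g x y z"
  using trilin_curry[OF assms(1,2)] assms(1,3) by (simp add: tens_def trilin_def)

section \<open>The co-Jacobi identity on trilinear forms\<close>

text \<open>
  The value of \<open>(\<delta> \<otimes> id) (\<delta> x)\<close> at the trilinear form \<open>g\<close>.
\<close>

definition double_cobracket where
  "double_cobracket \<delta> x g = \<delta> x (\<lambda>y z. \<delta> y (\<lambda>p q. g p q z))"

lemma double_cobracket_bilin:
  assumes "space_on s L" "linear_on s L fscale (tensor2 s L) \<delta>" "trilin s L g"
  shows "bilin s L (\<lambda>y z. \<delta> y (\<lambda>p q. g p q z))"
  using assms(2) trilin_slice[OF assms(3) _ assms(1)]
  by (auto simp: bilinear_on_def) (auto simp: linear_on_def fscale_def)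

lemma lift_cobracket_apply:
  assumes sp: "space_on s L" and del: "linear_on s L fscale (tensor2 s L) \<delta>" and x: "x \<in> L"
  shows "lift (\<lambda>y z. tens fscale (tensor2 s L) s L (\<delta> y) z) (\<delta> x) G
    = double_cobracket \<delta> x (\<lambda>p q z. tens3 s L p q z G)"
proof -
  have T: "\<delta> y \<in> tensor2 s L" if "y \<in> L" for y using del that by (auto simp: linear_on_def)
  have lin: "linear_on fscale (tensor2 s L) (*) UNIV (\<lambda>t. tens fscale (tensor2 s L) s L t z G)"
    if "z \<in> L" for z
    using bilinear_on_tens[OF space_on_tensor_space[of s L s L] sp] that
    by (auto simp: bilinear_on_def linear_on_def fscale_def)
  show ?thesis
    unfolding lift_def double_cobracket_def
    by (rule tensor_cong[OF T[OF x] sp sp]) (rule linear_form_tensor[OF lin T sp sp])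
qed

lemma cycle3_apply:
  "cycle3 s L w G = w (\<lambda>t z. t (\<lambda>x y. rot (\<lambda>p q z. tens3 s L p q z G) x y z))"
  by (simp add: cycle3_def lift_def rot_def)

lemma double_cobracket_cong:
  assumes sp: "space_on s L" and del: "linear_on s L fscale (tensor2 s L) \<delta>" and x: "x \<in> L"
    and eq: "\<And>p q z. p \<in> L \<Longrightarrow> q \<in> L \<Longrightarrow> z \<in> L \<Longrightarrow> g p q z = h p q z"
  shows "double_cobracket \<delta> x g = double_cobracket \<delta> x h"
proof -
  have T: "\<delta> y \<in> tensor2 s L" if "y \<in> L" for y using del that by (auto simp: linear_on_def)
  show ?thesis unfolding double_cobracket_def
    by (intro tensor_cong[OF T[OF x] sp sp] tensor_cong[OF T sp sp] eq)
qed

text \<open>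
  The co-Jacobi identity tested on trilinear forms: \<^const>\<open>cycle3\<close> acts on a tensor by rotating the
  arguments of the form at which it is evaluated.
\<close>

lemma co_jacobi_iff:
  assumes sp: "space_on s L" and del: "linear_on s L fscale (tensor2 s L) \<delta>" and x: "x \<in> L"
  defines "w \<equiv> lift (\<lambda>y z. tens fscale (tensor2 s L) s L (\<delta> y) z) (\<delta> x)"
  shows "w + cycle3 s L w + cycle3 s L (cycle3 s L w) = 0 \<longleftrightarrow>
    (\<forall>g. trilin s L g \<longrightarrow> double_cobracket \<delta> x g + double_cobracket \<delta> x (rot g)
       + double_cobracket \<delta> x (rot (rot g)) = 0)"
proof -
  note W = lift_cobracket_apply[OF sp del x, folded w_def]
  note cong = double_cobracket_cong[OF sp del x]
  let ?t = "\<lambda>G p q z. tens3 s L p q z G"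
  let ?c = "\<lambda>g t z. t (\<lambda>x y. g x y z)"
  have W_curry: "w (?c g) = double_cobracket \<delta> x g" if "trilin s L g" for g
    unfolding W by (rule cong) (rule tens3_curry[OF that sp])
  have C1: "cycle3 s L w G = double_cobracket \<delta> x (rot (?t G))" for G
    unfolding cycle3_apply by (intro W_curry trilin_rot trilin_tens3 sp)
  have C2: "cycle3 s L (cycle3 s L w) G = double_cobracket \<delta> x (rot (rot (?t G)))" for G
    unfolding cycle3_apply[of s L "cycle3 s L w"] C1
    by (rule cong)
      (auto simp: rot_def intro!: tens3_curry[OF trilin_rot[OF trilin_tens3[OF sp]] sp, unfolded rot_def])
  show ?thesis
  proof (intro iffI allI impI)
    fix g assume 0: "w + cycle3 s L w + cycle3 s L (cycle3 s L w) = 0" and g: "trilin s L g"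
    have "(w + cycle3 s L w + cycle3 s L (cycle3 s L w)) (?c g) = 0" unfolding 0 by simp
    moreover have "double_cobracket \<delta> x (?t (?c g)) = double_cobracket \<delta> x g"
      "double_cobracket \<delta> x (rot (?t (?c g))) = double_cobracket \<delta> x (rot g)"
      "double_cobracket \<delta> x (rot (rot (?t (?c g)))) = double_cobracket \<delta> x (rot (rot g))"
      by (auto simp: rot_def intro!: cong tens3_curry[OF g sp])
    ultimately show "double_cobracket \<delta> x g + double_cobracket \<delta> x (rot g)
       + double_cobracket \<delta> x (rot (rot g)) = 0"
      by (simp add: W C1 C2)
  next
    assume "\<forall>g. trilin s L g \<longrightarrow> double_cobracket \<delta> x g + double_cobracket \<delta> x (rot g)
       + double_cobracket \<delta> x (rot (rot g)) = 0"
    then show "w + cycle3 s L w + cycle3 s L (cycle3 s L w) = 0"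
      using trilin_tens3[OF sp] by (simp add: fun_eq_iff W C1 C2)
  qed
qed

section \<open>Dual Lie algebras and coadjoint representations\<close>

lemma space_on_dual:
  assumes "space_on s L"
  shows "space_on fscale (dual s L)"
  unfolding space_on_def
  by (intro conjI fscale.vector_space_axioms fscale.subspaceI)
     (auto simp: dual_def linear_on_def fscale_def algebra_simps)

lemma transpose_on_linear:
  assumes "linear_on s L s L f" "space_on s L"
  shows "linear_on fscale (dual s L) fscale (dual s L) (transpose_on L f)"
  using assms space_on_closed[OF assms(2)]
  by (auto simp: linear_on_def dual_def transpose_on_def fscale_def fun_eq_iff)

lemma coadjoint_representation:
  assumes "lie_algebra s L br"
  shows "lie_representation s L br fscale (dual s L) (coadjoint L br)"
proof -
  have sp: "space_on s L" and b: "bilinear_on s L s L s L br" and alt: "\<forall>x\<in>L. br x x = 0"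
    and jac: "\<forall>x\<in>L. \<forall>y\<in>L. \<forall>z\<in>L. br x (br y z) + br y (br z x) + br z (br x y) = 0"
    using assms by (auto simp: lie_algebra_def)
  have cl: "br x y \<in> L" if "x \<in> L" "y \<in> L" for x y
    using b that by (auto simp: bilinear_on_def linear_on_def)
  have anti: "br y x = - br x y" if "x \<in> L" "y \<in> L" for x y
    by (rule alternating_antisym[OF sp b _ that]) (use alt in blast)
  have neg: "br z (- y) = - br z y" if "z \<in> L" "y \<in> L" for z y
    by (rule linear_on_simps(2)[of s L s L]) (use b sp that in \<open>auto simp: bilinear_on_def\<close>)
  have eq: "f (br (br x y) z) = f (br x (br y z)) - f (br y (br x z))"
    if f: "f \<in> dual s L" and x: "x \<in> L" "y \<in> L" "z \<in> L" for f x y z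
  proof -
    have "br (br x y) z + br y (br x z) = br x (br y z)"
      using jac[rule_format, OF x] anti[of z "br x y"] anti[of x z] neg[of y "br x z"] cl x
      by (simp add: algebra_simps)
    moreover have "f (br (br x y) z + br y (br x z)) = f (br (br x y) z) + f (br y (br x z))"
      using f cl x by (auto simp: dual_def linear_on_def)
    ultimately show ?thesis by simp
  qed
  have "bilinear_on s L fscale (dual s L) fscale (dual s L) (coadjoint L br)"
    using b cl space_on_closed[OF sp]
    by (auto simp: bilinear_on_def linear_on_def dual_def coadjoint_def fscale_def fun_eq_iff)
  then show ?thesis
    using assms space_on_dual[OF sp] cl
    by (auto simp: lie_representation_def coadjoint_def fun_eq_iff eq[simplified])
qed

text \<open>
  The coadjoint action is a representation for every Lie algebra, so only the compatibility of
  \<open>p\<^sup>*\<close> with \<open>d\<close> is left; evaluated at \<open>y\<close> it is the displayed equation up to an overall sign.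
\<close>

lemma adjoint_admissible_iff:
  fixes s :: "'k::field \<Rightarrow> 'a::ab_group_add \<Rightarrow> 'a"
  assumes "diff_lie_algebra lam s L br d" "linear_on s L s L p"
  shows "adjoint_admissible lam s L br d p \<longleftrightarrow>
    (\<forall>f\<in>dual s L. \<forall>x\<in>L. \<forall>y\<in>L.
       f (br x (p y)) = f (br (d x) y) + f (p (br x y)) + lam * f (p (br (d x) y)))"
proof -
  have lie: "lie_algebra s L br" and d: "linear_on s L s L d"
    using assms(1) by (auto simp: diff_lie_algebra_def)
  then have sp: "space_on s L" and cl: "\<And>x y. x \<in> L \<Longrightarrow> y \<in> L \<Longrightarrow> br x y \<in> L"
    by (auto simp: lie_algebra_def bilinear_on_def linear_on_def)
  have "transpose_on L p (coadjoint L br x f) = coadjoint L br (d x) f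
      + coadjoint L br x (transpose_on L p f) + fscale lam (coadjoint L br (d x) (transpose_on L p f))
    \<longleftrightarrow> (\<forall>y\<in>L. f (br x (p y)) = f (br (d x) y) + f (p (br x y)) + lam * f (p (br (d x) y)))"
    if "x \<in> L" for x and f :: "'a \<Rightarrow> 'k"
  proof -
    have "- a = - b + - c + - e \<longleftrightarrow> a = b + c + e" for a b c e :: 'k
      by (metis (no_types) add_minus_cancel minus_add_distrib minus_minus add.commute add.assoc)
    then show ?thesis
      using that cl d assms(2)
      by (auto simp: fun_eq_iff transpose_on_def coadjoint_def fscale_def linear_on_def)
  qed
  then show ?thesis
    unfolding adjoint_admissible_def diff_lie_representation_def
    using assms coadjoint_representation[OF lie] transpose_on_linear[OF assms(2) sp] by blast
qed

lemma dual_bilin: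
  assumes "a \<in> dual s L" "b \<in> dual s L"
  shows "bilin s L (\<lambda>x y. a x * b y)"
  using assms by (auto simp: dual_def bilinear_on_def linear_on_def algebra_simps)

text \<open>
  Each axiom is the transpose of the corresponding co-axiom.  The alternating law uses that
  \<open>a \<otimes> a\<close> is a symmetric form, hence vanishes on tensors \<open>u - \<tau> u\<close>; the Jacobi identity is the
  co-Jacobi identity at the trilinear form \<open>a \<otimes> b \<otimes> c\<close>.
\<close>

lemma dual_lie_algebra:
  assumes "lie_coalgebra s L \<delta>"
  shows "lie_algebra fscale (dual s L) (dual_bracket L \<delta>)"
proof -
  have sp: "space_on s L" and del: "linear_on s L fscale (tensor2 s L) \<delta>"
    and coalt: "\<And>x. x \<in> L \<Longrightarrow> \<exists>u\<in>tensor2 s L. \<delta> x = u - flip s L u"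
    and cj: "\<And>x g. x \<in> L \<Longrightarrow> trilin s L g \<Longrightarrow> double_cobracket \<delta> x g + double_cobracket \<delta> x (rot g)
       + double_cobracket \<delta> x (rot (rot g)) = 0"
    using assms co_jacobi_iff[of s L \<delta>] unfolding lie_coalgebra_def Let_def by blast+
  have T: "\<delta> y \<in> tensor2 s L" if "y \<in> L" for y using del that by (auto simp: linear_on_def)
  let ?b = "dual_bracket L \<delta>"
  have b: "?b a b x = \<delta> x (\<lambda>p q. a p * b q)" if "x \<in> L" for a b x
    using that by (simp add: dual_bracket_def tensor_pair_def)
  have cl: "?b a b \<in> dual s L" if "a \<in> dual s L" "b \<in> dual s L" for a b
    using del space_on_closed[OF sp]
    by (auto simp: dual_def dual_bracket_def tensor_pair_def linear_on_def fscale_def)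
  have ext: "f = g" if "f \<in> dual s L" "g \<in> dual s L" "\<And>x. x \<in> L \<Longrightarrow> f x = g x" for f g
  proof
    show "f x = g x" for x using that by (cases "x \<in> L") (auto simp: dual_def)
  qed
  note dcl = space_on_closed[OF space_on_dual[OF sp]]
  have addr: "?b a (b + c) = ?b a b + ?b a c" "?b (b + c) a = ?b b a + ?b c a"
    if "a \<in> dual s L" "b \<in> dual s L" "c \<in> dual s L" for a b c
    using that tensor_add[OF T sp dual_bilin dual_bilin, of _ a b a c]
       tensor_add[OF T sp dual_bilin dual_bilin, of _ b a c a]
    by (auto intro!: ext cl dcl simp: b algebra_simps)
  have scaler: "?b a (fscale k b) = fscale k (?b a b)" "?b (fscale k a) b = fscale k (?b a b)"
    if "a \<in> dual s L" "b \<in> dual s L" for a b k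
    using that tensor_scale[OF T sp dual_bilin, of _ a b k]
    by (auto intro!: ext cl dcl simp: b) (auto simp: fscale_def algebra_simps b)
  have bil: "bilinear_on fscale (dual s L) fscale (dual s L) fscale (dual s L) ?b"
    using cl addr scaler by (auto simp: bilinear_on_def linear_on_def)
  have alt: "?b a a = 0" if a: "a \<in> dual s L" for a
  proof (rule ext)
    fix x assume x: "x \<in> L"
    then obtain u where "\<delta> x = u - flip s L u" using coalt by blast
    then show "?b a a x = 0 x"
      by (simp add: b x flip_apply[OF dual_bilin[OF a a]] mult.commute)
  qed (use a cl dcl in auto)
  have anti: "?b a b = - ?b b a" if "a \<in> dual s L" "b \<in> dual s L" for a b
    by (rule alternating_antisym[OF space_on_dual[OF sp] bil alt that(2,1)])
  have nested: "?b (?b a b) c x = double_cobracket \<delta> x (\<lambda>p q z. a p * b q * c z)"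
    if "a \<in> dual s L" "b \<in> dual s L" "c \<in> dual s L" "x \<in> L" for a b c x
    unfolding double_cobracket_def b[OF that(4)]
  proof (rule tensor_cong[OF T[OF that(4)] sp sp])
    fix y z assume "y \<in> L" "z \<in> L"
    then show "?b a b y * c z = \<delta> y (\<lambda>p q. a p * b q * c z)"
      using tensor_scale[OF T sp dual_bilin[OF that(1,2)], of y "c z"] by (simp add: b algebra_simps)
  qed
  have "?b a (?b b c) + ?b b (?b c a) + ?b c (?b a b) = 0"
    if abc: "a \<in> dual s L" "b \<in> dual s L" "c \<in> dual s L" for a b c
  proof (rule ext)
    fix x assume x: "x \<in> L"
    let ?g = "\<lambda>p q z. a p * b q * c z"
    have "trilin s L ?g" using abc
      by (auto simp: trilin_def bilinear_on_def linear_on_def dual_def algebra_simps)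
    note cj[OF x this]
    moreover have "rot ?g = (\<lambda>p q z. c p * a q * b z)" "rot (rot ?g) = (\<lambda>p q z. b p * c q * a z)"
      by (auto simp: rot_def fun_eq_iff)
    ultimately have "?b (?b a b) c x + ?b (?b c a) b x + ?b (?b b c) a x = 0"
      by (simp add: nested abc x)
    then have "- (?b (?b b c) a x + ?b (?b c a) b x + ?b (?b a b) c x) = 0"
      by (simp add: algebra_simps)
    then show "(?b a (?b b c) + ?b b (?b c a) + ?b c (?b a b)) x = 0 x"
      using anti[of a "?b b c"] anti[of b "?b c a"] anti[of c "?b a b"] abc cl by simp
  qed (use abc cl dcl in auto)
  then show ?thesis
    using bil alt space_on_dual[OF sp] by (auto simp: lie_algebra_def)
qed

lemma dual_diff_lie_algebra:
  fixes s :: "'k::field \<Rightarrow> 'a::ab_group_add \<Rightarrow> 'a"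
  assumes "diff_lie_coalgebra lam s L \<delta> D"
  shows "diff_lie_algebra lam fscale (dual s L) (dual_bracket L \<delta>) (transpose_on L D)"
proof -
  have co: "lie_coalgebra s L \<delta>" and D: "linear_on s L s L D"
    and eq: "\<And>x. x \<in> L \<Longrightarrow> \<delta> (D x) = tensor_map s L D id (\<delta> x) + tensor_map s L id D (\<delta> x)
       + fscale lam (tensor_map s L D D (\<delta> x))"
    using assms by (auto simp: diff_lie_coalgebra_def)
  have sp: "space_on s L" and del: "linear_on s L fscale (tensor2 s L) \<delta>"
    using co by (auto simp: lie_coalgebra_def)
  have T: "\<delta> y \<in> tensor2 s L" if "y \<in> L" for y using del that by (auto simp: linear_on_def)
  have "transpose_on L D (dual_bracket L \<delta> a b) = dual_bracket L \<delta> (transpose_on L D a) b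
      + dual_bracket L \<delta> a (transpose_on L D b)
      + fscale lam (dual_bracket L \<delta> (transpose_on L D a) (transpose_on L D b))"
    if "a \<in> dual s L" "b \<in> dual s L" for a b
  proof
    fix x
    show "transpose_on L D (dual_bracket L \<delta> a b) x = (dual_bracket L \<delta> (transpose_on L D a) b
      + dual_bracket L \<delta> a (transpose_on L D b)
      + fscale lam (dual_bracket L \<delta> (transpose_on L D a) (transpose_on L D b))) x"
    proof (cases "x \<in> L")
      case True
      have "\<delta> x (\<lambda>p q. transpose_on L D a p * b q) = \<delta> x (\<lambda>p q. a (D p) * b q)"
        "\<delta> x (\<lambda>p q. a p * transpose_on L D b q) = \<delta> x (\<lambda>p q. a p * b (D q))"
        "\<delta> x (\<lambda>p q. transpose_on L D a p * transpose_on L D b q) = \<delta> x (\<lambda>p q. a (D p) * b (D q))"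
        by (rule tensor_cong[OF T[OF True] sp sp], simp add: transpose_on_def)+
      moreover have "D x \<in> L" using D True by (auto simp: linear_on_def)
      moreover have "transpose_on L D f x = f (D x)" for f :: "'a \<Rightarrow> 'k"
        using True by (simp add: transpose_on_def)
      ultimately show ?thesis
        using True eq[OF True]
        by (simp add: dual_bracket_def
          tensor_pair_def tensor_map_apply[OF dual_bilin[OF that]] fscale_def)
    qed (simp add: transpose_on_def dual_bracket_def fscale_def)
  qed
  then show ?thesis
    using dual_lie_algebra[OF co] transpose_on_linear[OF D sp] by (auto simp: diff_lie_algebra_def)
qed

section \<open>Coboundary cobracket of a skew-symmetric tensor\<close>

text \<open>
  The parameters \<open>n\<close>, \<open>u\<close>, \<open>v\<close> fix a decomposition \<open>r = (\<Sum>i<n. u i \<otimes> v i)\<close>.  Working with it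
  replaces the functional \<open>r\<close>, which is additive on bilinear forms only, by the finite sum \<open>contr\<close>
  below, which is additive on all functions; then only the uses of skew-symmetry, of the Yang-Baxter
  equation and of the intertwining relation need multilinearity.
\<close>

locale skew_tensor =
  fixes s :: "'k::field \<Rightarrow> 'a::ab_group_add \<Rightarrow> 'a" and L :: "'a set" and br :: "'a \<Rightarrow> 'a \<Rightarrow> 'a"
    and r :: "('a \<Rightarrow> 'a \<Rightarrow> 'k) \<Rightarrow> 'k" and n :: nat and u v :: "nat \<Rightarrow> 'a"
  assumes lie: "lie_algebra s L br"
    and r_in: "r \<in> tensor2 s L"
    and skew: "r = - flip s L r"
    and uv: "i < n \<Longrightarrow> u i \<in> L" "i < n \<Longrightarrow> v i \<in> L"
    and r_sum: "bilin s L \<beta> \<Longrightarrow> r \<beta> = (\<Sum>i<n. \<beta> (u i) (v i))"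
begin

lemma space_L: "space_on s L"
  using lie by (simp add: lie_algebra_def)

lemma br_bilinear: "bilinear_on s L s L s L br"
  using lie by (simp add: lie_algebra_def)

lemmas L_closed = space_on_closed[OF space_L]

lemma br_linear: "x \<in> L \<Longrightarrow> linear_on s L s L (br x)" "y \<in> L \<Longrightarrow> linear_on s L s L (\<lambda>x. br x y)"
  using br_bilinear by (auto simp: bilinear_on_def)

lemma br_simps:
  "x \<in> L \<Longrightarrow> y \<in> L \<Longrightarrow> br x y \<in> L"
  "x \<in> L \<Longrightarrow> y \<in> L \<Longrightarrow> z \<in> L \<Longrightarrow> br (x + y) z = br x z + br y z"
  "x \<in> L \<Longrightarrow> y \<in> L \<Longrightarrow> z \<in> L \<Longrightarrow> br x (y + z) = br x y + br x z"
  "x \<in> L \<Longrightarrow> y \<in> L \<Longrightarrow> br (s c x) y = s c (br x y)"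
  "x \<in> L \<Longrightarrow> y \<in> L \<Longrightarrow> br x (s c y) = s c (br x y)"
  using br_bilinear by (auto simp: bilinear_on_def linear_on_def)

lemma br_antisym: "x \<in> L \<Longrightarrow> y \<in> L \<Longrightarrow> br y x = - br x y"
  by (rule alternating_antisym[OF space_L br_bilinear]) (use lie in \<open>auto simp: lie_algebra_def\<close>)

lemma br_jacobi:
  assumes "x \<in> L" "y \<in> L" "z \<in> L"
  shows "br x (br y z) = br (br x y) z - br (br x z) y"
proof -
  have "br x (br y z) + br y (br z x) + br z (br x y) = 0"
    using lie assms by (auto simp: lie_algebra_def)
  moreover have "br y (br z x) = br (br x z) y"
  proof -
    have "br y (br z x) = - br (br z x) y"
      using br_antisym[of "br z x" y] assms br_simps(1) by simp
    also have "\<dots> = br (br x z) y"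
      using br_antisym[of x z] linear_on_simps(2)[OF br_linear(2)[of y] space_L, of "br x z"]
        assms br_simps(1) by simp
    finally show ?thesis .
  qed
  moreover have "br z (br x y) = - br (br x y) z"
    using br_antisym[of "br x y" z] assms br_simps(1) by simp
  ultimately show ?thesis by (simp add: algebra_simps)
qed

definition contr :: "('a \<Rightarrow> 'a \<Rightarrow> 'k) \<Rightarrow> 'k" where
  "contr F = (\<Sum>i<n. F (u i) (v i))"

lemma contr_cong: "(\<And>x y. x \<in> L \<Longrightarrow> y \<in> L \<Longrightarrow> F x y = G x y) \<Longrightarrow> contr F = contr G"
  by (auto simp: contr_def uv intro!: sum.cong)

lemma contr_add: "contr (\<lambda>x y. F x y + G x y) = contr F + contr G"
  by (simp add: contr_def sum.distrib)

lemma contr_minus: "contr (\<lambda>x y. - F x y) = - contr F"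
  by (simp add: contr_def sum_negf)

lemma contr_scale: "contr (\<lambda>x y. c * F x y) = c * contr F"
  by (simp add: contr_def sum_distrib_left)

lemma contr_commute: "contr (\<lambda>a b. contr (F a b)) = contr (\<lambda>p q. contr (\<lambda>a b. F a b p q))"
  unfolding contr_def by (rule sum.swap)

lemma r_contr: "bilin s L \<beta> \<Longrightarrow> r \<beta> = contr \<beta>"
  by (simp add: r_sum contr_def)

lemma bilin_flip: "bilin s L \<beta> \<Longrightarrow> bilin s L (\<lambda>x y. \<beta> y x)"
  by (auto simp: bilinear_on_def)

lemma bilin_comp: "bilin s L \<beta> \<Longrightarrow> linear_on s L s L f \<Longrightarrow> linear_on s L s L g \<Longrightarrow>
   bilin s L (\<lambda>x y. \<beta> (f x) (g y))"
  by (auto simp: bilinear_on_def linear_on_def)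

lemma linear_id: "linear_on s L s L id" "linear_on s L s L (\<lambda>x. x)"
  by (auto simp: linear_on_def)

text \<open>
  Skew-symmetry of \<open>r\<close> on forms: the two legs of \<open>r\<close> may be exchanged in a bilinear
  expression at the cost of a sign.
\<close>

lemma contr_skew:
  assumes "bilin s L \<beta>"
  shows "contr \<beta> = - contr (\<lambda>x y. \<beta> y x)"
proof -
  have "r \<beta> = (- flip s L r) \<beta>" using skew by simp
  also have "\<dots> = - r (\<lambda>x y. \<beta> y x)" by (simp add: flip_apply[OF assms])
  finally show ?thesis using assms bilin_flip[OF assms] by (simp add: r_contr)
qed

abbreviation \<delta> where "\<delta> \<equiv> delta_r s L br r"

lemma delta_apply:
  assumes "bilin s L \<beta>" "x \<in> L"
  shows "\<delta> x \<beta> = contr (\<lambda>a b. \<beta> (br x a) b + \<beta> a (br x b))"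
  using bilin_comp[OF assms(1) br_linear(1)[OF assms(2)] linear_id(2)]
    bilin_comp[OF assms(1) linear_id(2) br_linear(1)[OF assms(2)]]
  by (simp add: delta_r_def ad2_def tensor_map_apply assms r_contr contr_add)

lemma delta_in: "x \<in> L \<Longrightarrow> \<delta> x \<in> tensor2 s L"
  unfolding delta_r_def ad2_def
  using space_on_closed(2)[OF space_on_tensor_space]
    tensor_map_in_tensor2[OF space_L] br_linear(1) linear_id(1) r_in
  by blast

lemma delta_linear: "linear_on s L fscale (tensor2 s L) \<delta>"
  unfolding linear_on_def
proof (intro conjI ballI allI)
  note tcl = space_on_closed[OF space_on_tensor_space]
  fix x y assume x: "x \<in> L" "y \<in> L"
  show "\<delta> (x + y) = \<delta> x + \<delta> y"
  proof (rule tensor_eqI[OF _ _ space_L])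
    fix \<beta> assume b: "bilin s L \<beta>"
    have "\<delta> (x + y) \<beta> = contr (\<lambda>a b. (\<beta> (br x a) b + \<beta> a (br x b)) + (\<beta> (br y a) b + \<beta> a (br y b)))"
      unfolding delta_apply[OF b L_closed(2)[OF x]] using b x
      by (intro contr_cong) (auto simp: br_simps bilinear_on_def linear_on_def)
    then show "\<delta> (x + y) \<beta> = (\<delta> x + \<delta> y) \<beta>"
      by (simp add: delta_apply[OF b] x contr_add)
  qed (auto intro!: delta_in tcl L_closed x)
next
  note tcl = space_on_closed[OF space_on_tensor_space]
  fix c x assume x: "x \<in> L"
  show "\<delta> (s c x) = fscale c (\<delta> x)"
  proof (rule tensor_eqI[OF _ _ space_L])
    fix \<beta> assume b: "bilin s L \<beta>"
    have "\<delta> (s c x) \<beta> = contr (\<lambda>a b. c * (\<beta> (br x a) b + \<beta> a (br x b)))"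
      unfolding delta_apply[OF b L_closed(3)[OF x]] using b x
      by (intro contr_cong) (auto simp: br_simps bilinear_on_def linear_on_def algebra_simps)
    then show "\<delta> (s c x) \<beta> = fscale c (\<delta> x) \<beta>"
      by (simp add: delta_apply[OF b] x contr_scale fscale_def)
  qed (auto intro!: delta_in tcl L_closed x)
qed (rule delta_in)

text \<open>
  Skew-symmetry turns the second half of \<open>\<delta> x\<close> into the flip of the first half:
  \<open>(id \<otimes> ad x) r = - \<tau> ((ad x \<otimes> id) r)\<close>.  This gives \<open>\<delta> x\<close> the form \<open>t - \<tau> t\<close> in every characteristic,
  including 2.
\<close>

lemma delta_coalternating:
  assumes x: "x \<in> L"
  shows "\<exists>t\<in>tensor2 s L. \<delta> x = t - flip s L t"
proof
  let ?t = "tensor_map s L (br x) id r"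
  show "\<delta> x = ?t - flip s L ?t"
  proof
    fix \<beta>
    show "\<delta> x \<beta> = (?t - flip s L ?t) \<beta>"
    proof (cases "bilin s L \<beta>")
      case True
      have l: "bilin s L (\<lambda>a b. \<beta> (br x a) b)" and m: "bilin s L (\<lambda>a b. \<beta> a (br x b))"
        using bilin_comp[OF True] br_linear(1)[OF x] linear_id(2) by blast+
      show ?thesis
        using bilin_flip[OF m] contr_skew[OF m]
        by (simp add: delta_apply[OF True x] flip_apply[OF True] tensor_map_apply True
           bilin_flip r_contr l contr_add)
    next
      case False
      have zero: "bilin s L (\<lambda>_ _. 0)" by (simp add: bilinear_on_def linear_on_def)
      have "flip s L ?t \<beta> = r (\<lambda>_ _. 0)"
        using False by (simp add: flip_def lift_def tensor_map_def tens_def zero)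
      also have "\<dots> = 0" by (simp add: r_contr zero contr_def)
      finally show ?thesis
        using tensor_not_bilinear[OF delta_in[OF x] space_L False]
          tensor_not_bilinear[OF tensor_map_in_tensor2[OF space_L br_linear(1)[OF x]
            linear_id(1) r_in] space_L False]
        by simp
    qed
  qed
qed (intro tensor_map_in_tensor2 space_L br_linear(1) linear_id r_in x)

text \<open>
  \<open>\<delta>\<close> is a coboundary, hence a cocycle: the action of \<open>L\<close> on \<open>L \<otimes> L\<close> satisfies
  \<open>[x,y] \<cdot> r = x \<cdot> (y \<cdot> r) - y \<cdot> (x \<cdot> r)\<close>.  The mixed terms \<open>[x,a] \<otimes> [y,b] + [y,a] \<otimes> [x,b]\<close> cancel, and the
  others are the Jacobi identity in one leg.
\<close>

lemma delta_cocycle: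
  assumes x: "x \<in> L" "y \<in> L"
  shows "\<delta> (br x y) = ad2 s L br x (\<delta> y) - ad2 s L br y (\<delta> x)"
proof (rule tensor_eqI[OF _ _ space_L])
  have "ad2 s L br x (\<delta> y) \<in> tensor2 s L" if "x \<in> L" "y \<in> L" for x y
    unfolding ad2_def using that
    by (intro space_on_closed[OF space_on_tensor_space] tensor_map_in_tensor2
      delta_in space_L br_linear(1) linear_id)
  then show "ad2 s L br x (\<delta> y) - ad2 s L br y (\<delta> x) \<in> tensor2 s L"
    using x by (intro space_on_closed[OF space_on_tensor_space])
  show "\<delta> (br x y) \<in> tensor2 s L" using x by (intro delta_in br_simps)
  fix \<beta> assume b: "bilin s L \<beta>"
  have ad: "ad2 s L br x (\<delta> y) \<beta> = contr (\<lambda>a b. (\<beta> (br x (br y a)) b + \<beta> (br x a) (br y b))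
       + (\<beta> (br y a) (br x b) + \<beta> a (br x (br y b))))" if x: "x \<in> L" "y \<in> L" for x y
    using bilin_comp[OF b br_linear(1)[OF x(1)] linear_id(2)]
      bilin_comp[OF b linear_id(2) br_linear(1)[OF x(1)]] x
    by (simp add: ad2_def tensor_map_apply[OF b] delta_apply contr_add)
  have "\<delta> (br x y) \<beta> + ad2 s L br y (\<delta> x) \<beta> = ad2 s L br x (\<delta> y) \<beta>"
    unfolding ad[OF x] ad[OF x(2,1)] delta_apply[OF b br_simps(1)[OF x]] contr_add[symmetric]
  proof (rule contr_cong)
    fix a b assume ab: "a \<in> L" "b \<in> L"
    have jac: "br (br x y) c = br x (br y c) - br y (br x c)" if c: "c \<in> L" for c
    proof -
      have "br y (br x c) = - br (br x c) y"
        using br_antisym[of "br x c" y] br_simps(1) x c by simp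
      then show ?thesis using br_jacobi[OF x c] by simp
    qed
    have l: "linear_on s L (*) UNIV (\<lambda>c. \<beta> c b)" "linear_on s L (*) UNIV (\<beta> a)"
      using b ab by (auto simp: bilinear_on_def)
    show "\<beta> (br (br x y) a) b + \<beta> a (br (br x y) b)
      + (\<beta> (br y (br x a)) b + \<beta> (br y a) (br x b) + (\<beta> (br x a) (br y b) + \<beta> a (br y (br x b))))
      = \<beta> (br x (br y a)) b + \<beta> (br x a) (br y b) + (\<beta> (br y a) (br x b) + \<beta> a (br x (br y b)))"
      using linear_on_simps(3)[OF l(1) space_L] linear_on_simps(3)[OF l(2) space_L] x ab
      by (simp add: jac br_simps)
  qed
  then show "\<delta> (br x y) \<beta> = (ad2 s L br x (\<delta> y) - ad2 s L br y (\<delta> x)) \<beta>"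
    by (simp add: algebra_simps)
qed

lemma trilin_simps:
  assumes "trilin s L g"
  shows
  "x \<in> L \<Longrightarrow> x' \<in> L \<Longrightarrow> y \<in> L \<Longrightarrow> z \<in> L \<Longrightarrow> g (x + x') y z = g x y z + g x' y z"
  "x \<in> L \<Longrightarrow> y \<in> L \<Longrightarrow> y' \<in> L \<Longrightarrow> z \<in> L \<Longrightarrow> g x (y + y') z = g x y z + g x y' z"
  "x \<in> L \<Longrightarrow> y \<in> L \<Longrightarrow> z \<in> L \<Longrightarrow> z' \<in> L \<Longrightarrow> g x y (z + z') = g x y z + g x y z'"
  "x \<in> L \<Longrightarrow> y \<in> L \<Longrightarrow> z \<in> L \<Longrightarrow> g (s c x) y z = c * g x y z"
  "x \<in> L \<Longrightarrow> y \<in> L \<Longrightarrow> z \<in> L \<Longrightarrow> g x (s c y) z = c * g x y z"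
  "x \<in> L \<Longrightarrow> y \<in> L \<Longrightarrow> z \<in> L \<Longrightarrow> g x y (s c z) = c * g x y z"
  using assms by (auto simp: trilin_def bilinear_on_def linear_on_def)

lemma trilin_neg_diff:
  assumes g: "trilin s L g" and x: "x \<in> L" "y \<in> L" "z \<in> L"
  shows "g (- x) y z = - g x y z" "g x (- y) z = - g x y z" "g x y (- z) = - g x y z"
    "w \<in> L \<Longrightarrow> g (x - w) y z = g x y z - g w y z"
    "w \<in> L \<Longrightarrow> g x (y - w) z = g x y z - g x w z"
    "w \<in> L \<Longrightarrow> g x y (z - w) = g x y z - g x y w"
proof -
  have l: "linear_on s L (*) UNIV (\<lambda>x. g x y z)" "linear_on s L (*) UNIV (\<lambda>y. g x y z)"
    "linear_on s L (*) UNIV (g x y)"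
    using g x by (auto simp: trilin_def bilinear_on_def)
  show "g (- x) y z = - g x y z" "g x (- y) z = - g x y z" "g x y (- z) = - g x y z"
    "w \<in> L \<Longrightarrow> g (x - w) y z = g x y z - g w y z"
    "w \<in> L \<Longrightarrow> g x (y - w) z = g x y z - g x w z"
    "w \<in> L \<Longrightarrow> g x y (z - w) = g x y z - g x y w"
    using linear_on_simps[OF l(1) space_L] linear_on_simps[OF l(2) space_L]
      linear_on_simps[OF l(3) space_L] x
    by auto
qed

text \<open>
  The form \<open>t \<otimes> z \<mapsto> t (g \<cdot> \<cdot> z)\<close> on \<open>(L \<otimes> L) \<otimes> L\<close> is how a triple tensor is evaluated at a trilinear
  form \<open>g\<close>; so \<open>CYB r = 0\<close> says that the right-hand side vanishes for every \<open>g\<close>.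
\<close>

lemma CYB_apply:
  assumes g: "trilin s L g"
  shows "CYB s L br r (\<lambda>t z. t (\<lambda>x y. g x y z)) =
    contr (\<lambda>a b. contr (\<lambda>p q. g (br a p) b q + g a p (br b q) + g a (br b p) q))"
proof -
  let ?G = "\<lambda>t z. t (\<lambda>x y. g x y z)"
  let ?e = "\<lambda>a b p q. g (br a p) b q + g a p (br b q) + g a (br b p) q"
  have in1: "bilin s L (?e a b)" if "a \<in> L" "b \<in> L" for a b
    using that by (auto simp: bilinear_on_def linear_on_def br_simps trilin_simps[OF g] algebra_simps)
  have "CYB s L br r ?G = r (\<lambda>a b. r (\<lambda>p q. tens3 s L (br a p) b q ?G + tens3 s L a p (br b q) ?G
        + tens3 s L a (br b p) q ?G))"
    by (simp add: CYB_def lift_def)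
  also have "\<dots> = r (\<lambda>a b. r (?e a b))"
    by (intro tensor_cong[OF r_in space_L space_L]) (simp add: tens3_curry[OF g space_L] br_simps)
  also have "\<dots> = r (\<lambda>a b. contr (?e a b))"
    by (rule tensor_cong[OF r_in space_L space_L]) (simp add: r_contr in1)
  also have "\<dots> = contr (\<lambda>a b. contr (?e a b))"
  proof (rule r_contr)
    have "bilin s L (\<lambda>a b. ?e a b p q)" if "p \<in> L" "q \<in> L" for p q
      using that by (auto simp: bilinear_on_def linear_on_def br_simps trilin_simps[OF g] algebra_simps)
    then show "bilin s L (\<lambda>a b. contr (?e a b))"
      unfolding bilinear_on_def linear_on_def
      by (auto simp: contr_add[symmetric] contr_scale[symmetric] intro!: contr_cong)
  qed
  finally show ?thesis .
qed

text \<open>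
  Contraction with two copies of \<open>r\<close>.  The expressions in the co-Jacobi identity are rewritten by
  three symmetries: the copies may be exchanged, and the legs of either copy may be exchanged with a
  sign.
\<close>

definition contr2 :: "('a \<Rightarrow> 'a \<Rightarrow> 'a \<Rightarrow> 'a \<Rightarrow> 'k) \<Rightarrow> 'k" where
  "contr2 F = contr (\<lambda>a b. contr (F a b))"

definition quadrilin :: "('a \<Rightarrow> 'a \<Rightarrow> 'a \<Rightarrow> 'a \<Rightarrow> 'k) \<Rightarrow> bool" where
  "quadrilin F \<longleftrightarrow> (\<forall>a\<in>L. \<forall>b\<in>L. bilin s L (F a b)) \<and> (\<forall>p\<in>L. \<forall>q\<in>L. bilin s L (\<lambda>a b. F a b p q))"

lemma contr2_cong:
  "(\<And>a b p q. a \<in> L \<Longrightarrow> b \<in> L \<Longrightarrow> p \<in> L \<Longrightarrow> q \<in> L \<Longrightarrow> F a b p q = G a b p q) \<Longrightarrow> contr2 F = contr2 G"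
  unfolding contr2_def by (intro contr_cong)

lemma contr2_add: "contr2 (\<lambda>a b p q. F a b p q + G a b p q) = contr2 F + contr2 G"
  by (simp add: contr2_def contr_add)

lemma contr2_minus: "contr2 (\<lambda>a b p q. - F a b p q) = - contr2 F"
  by (simp add: contr2_def contr_minus)

lemma contr2_swap: "contr2 F = contr2 (\<lambda>a b p q. F p q a b)"
  unfolding contr2_def by (rule contr_commute)

lemma contr2_flip2:
  assumes "quadrilin F" shows "contr2 F = - contr2 (\<lambda>a b p q. F a b q p)"
proof -
  have "contr2 F = contr2 (\<lambda>a b p q. - F a b q p)"
    unfolding contr2_def
  proof (rule contr_cong)
    fix a b assume "a \<in> L" "b \<in> L"
    then show "contr (F a b) = contr (\<lambda>p q. - F a b q p)"
      using contr_skew[of "F a b"] assms by (simp add: quadrilin_def contr_minus)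
  qed
  then show ?thesis by (simp add: contr2_minus)
qed

lemma contr2_flip1:
  assumes "quadrilin F" shows "contr2 F = - contr2 (\<lambda>a b p q. F b a p q)"
proof -
  have "quadrilin (\<lambda>a b p q. F p q a b)" using assms by (auto simp: quadrilin_def)
  then show ?thesis
    using contr2_flip2[of "\<lambda>a b p q. F p q a b"] contr2_swap[of F]
      contr2_swap[of "\<lambda>a b p q. F b a p q"]
    by simp
qed

lemma double_cobracket_delta:
  assumes g: "trilin s L g" and x: "x \<in> L"
  shows "double_cobracket \<delta> x g =
    contr2 (\<lambda>a b p q. g (br (br x a) p) q b) + contr2 (\<lambda>a b p q. g p (br (br x a) q) b)
    + contr2 (\<lambda>a b p q. g (br a p) q (br x b)) + contr2 (\<lambda>a b p q. g p (br a q) (br x b))"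
proof -
  have "bilin s L (\<lambda>p q. g p q z)" if "z \<in> L" for z
    using g that by (auto simp: trilin_def)
  then have "double_cobracket \<delta> x g = contr (\<lambda>a b.
      contr (\<lambda>p q. g (br (br x a) p) q b + g p (br (br x a) q) b) +
      contr (\<lambda>p q. g (br a p) q (br x b) + g p (br a q) (br x b)))"
    unfolding double_cobracket_def delta_apply[OF double_cobracket_bilin[OF space_L delta_linear g] x]
    using x by (intro contr_cong) (simp add: delta_apply br_simps)
  then show ?thesis by (simp add: contr2_def contr_add add.assoc)
qed

text \<open>
  The co-Jacobi expression of \<open>\<delta>\<close> at \<open>x\<close> is the negative of \<open>x \<cdot> CYB r\<close>, where \<open>x\<close> acts on the three legs by
  the adjoint action.  With \<open>r = a \<otimes> b = p \<otimes> q\<close>, the double cobracket has four terms and so the cyclic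
  sum has twelve.  In six of them \<open>x\<close> acts on a leg outside the bracket of the two copies, and each is
  one of the six such terms of \<open>- x \<cdot> CYB r\<close> after exchanging copies or legs.  The other six contain
  \<open>[[x,a],p]\<close> up to such exchanges; they combine in pairs, by the Jacobi identity, to the three terms of
  \<open>- x \<cdot> CYB r\<close> in which \<open>x\<close> acts on the bracket.
\<close>

lemma delta_co_jacobi:
  assumes cyb: "CYB s L br r = 0" and g: "trilin s L g" and x: "x \<in> L"
  shows "double_cobracket \<delta> x g + double_cobracket \<delta> x (rot g)
    + double_cobracket \<delta> x (rot (rot g)) = 0"
proof -
  note q = quadrilin_def bilinear_on_def linear_on_def br_simps trilin_simps[OF g] algebra_simps x
  have cyb0: "contr2 (\<lambda>a b p q. h (br a p) b q) + contr2 (\<lambda>a b p q. h a p (br b q))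
      + contr2 (\<lambda>a b p q. h a (br b p) q) = 0" if h: "trilin s L h" for h
    using CYB_apply[OF h] cyb by (simp add: contr2_def contr_add)
  have h1: "trilin s L (\<lambda>a b c. g (br x a) b c)" and h2: "trilin s L (\<lambda>a b c. g a (br x b) c)"
    and h3: "trilin s L (\<lambda>a b c. g a b (br x c))"
    by (auto simp: trilin_def q)
  have anti: "g (br b a) y z = - g (br a b) y z" "g y (br b a) z = - g y (br a b) z"
    "g y z (br b a) = - g y z (br a b)"
    if "a \<in> L" "b \<in> L" "y \<in> L" "z \<in> L" for a b y z
    using that br_antisym[of a b] by (simp_all add: trilin_neg_diff[OF g] br_simps)
  \<comment> \<open>The six terms where \<open>x\<close> acts outside the bracket.\<close>
  have t1: "contr2 (\<lambda>a b p q. g (br a p) q (br x b)) = - contr2 (\<lambda>a b p q. g (br a p) b (br x q))"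
    unfolding contr2_minus[symmetric]
    by (subst contr2_swap, rule contr2_cong) (auto intro!: anti br_simps x)
  have t2: "contr2 (\<lambda>a b p q. g p (br a q) (br x b)) = - contr2 (\<lambda>a b p q. g a (br b p) (br x q))"
    unfolding contr2_minus[symmetric]
    by (subst contr2_swap, rule contr2_cong) (auto intro!: anti br_simps x)
  have t3: "contr2 (\<lambda>a b p q. g q (br x b) (br a p)) = - contr2 (\<lambda>a b p q. g a (br x p) (br b q))"
  proof -
    have "contr2 (\<lambda>a b p q. g q (br x b) (br a p)) = - contr2 (\<lambda>a b p q. g q (br x a) (br b p))"
      by (rule contr2_flip1) (auto simp: q)
    also have "\<dots>
        = contr2 (\<lambda>a b p q. g p (br x a) (br b q))" by (subst contr2_flip2) (auto simp: q)
    also have "\<dots> = contr2 (\<lambda>a b p q. g a (br x p) (br q b))" by (rule contr2_swap)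
    also have "\<dots> = - contr2 (\<lambda>a b p q. g a (br x p) (br b q))"
      unfolding contr2_minus[symmetric] by (rule contr2_cong) (auto intro!: anti br_simps x)
    finally show ?thesis .
  qed
  have t4: "contr2 (\<lambda>a b p q. g (br a q) (br x b) p) = - contr2 (\<lambda>a b p q. g (br a p) (br x b) q)"
    by (rule contr2_flip2) (auto simp: q)
  have t5: "contr2 (\<lambda>a b p q. g (br x b) (br a p) q) = - contr2 (\<lambda>a b p q. g (br x a) (br b p) q)"
    by (rule contr2_flip1) (auto simp: q)
  have t6: "contr2 (\<lambda>a b p q. g (br x b) p (br a q)) = - contr2 (\<lambda>a b p q. g (br x a) p (br b q))"
    by (rule contr2_flip1) (auto simp: q)
  \<comment> \<open>The three pairs that the Jacobi identity merges, one for each position of the bracket.\<close>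
  have j1: "contr2 (\<lambda>a b p q. g (br (br x a) p) q b) + contr2 (\<lambda>a b p q. g (br (br x a) q) b p)
      = - contr2 (\<lambda>a b p q. g (br x (br a p)) b q)"
  proof -
    have "contr2 (\<lambda>a b p q. g (br (br x a) p) q b) = contr2 (\<lambda>a b p q. g (br (br x p) a) b q)"
      by (rule contr2_swap)
    moreover have "contr2 (\<lambda>a b p q. g (br (br x a) q) b p)
        = - contr2 (\<lambda>a b p q. g (br (br x a) p) b q)"
      by (rule contr2_flip2) (auto simp: q)
    moreover have "- contr2 (\<lambda>a b p q. g (br x (br a p)) b q)
        = contr2 (\<lambda>a b p q. g (br (br x p) a) b q) + - contr2 (\<lambda>a b p q. g (br (br x a) p) b q)"
      unfolding contr2_minus[symmetric] contr2_add[symmetric]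
      by (rule contr2_cong) (simp add: br_jacobi trilin_neg_diff[OF g] br_simps x)
    ultimately show ?thesis by simp
  qed
  have j2: "contr2 (\<lambda>a b p q. g p (br (br x a) q) b) + contr2 (\<lambda>a b p q. g b (br (br x a) p) q)
      = - contr2 (\<lambda>a b p q. g a (br x (br b p)) q)"
  proof -
    have "contr2 (\<lambda>a b p q. g p (br (br x a) q) b) = contr2 (\<lambda>a b p q. g a (br (br x p) b) q)"
      by (rule contr2_swap)
    moreover have "contr2 (\<lambda>a b p q. g b (br (br x a) p) q)
        = - contr2 (\<lambda>a b p q. g a (br (br x b) p) q)"
      by (rule contr2_flip1) (auto simp: q)
    moreover have "- contr2 (\<lambda>a b p q. g a (br x (br b p)) q)
        = contr2 (\<lambda>a b p q. g a (br (br x p) b) q) + - contr2 (\<lambda>a b p q. g a (br (br x b) p) q)"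
      unfolding contr2_minus[symmetric] contr2_add[symmetric]
      by (rule contr2_cong) (simp add: br_jacobi trilin_neg_diff[OF g] br_simps x)
    ultimately show ?thesis by simp
  qed
  have j3: "contr2 (\<lambda>a b p q. g q b (br (br x a) p)) + contr2 (\<lambda>a b p q. g b p (br (br x a) q))
      = - contr2 (\<lambda>a b p q. g a p (br x (br b q)))"
  proof -
    have "contr2 (\<lambda>a b p q. g q b (br (br x a) p)) = contr2 (\<lambda>a b p q. g a p (br (br x q) b))"
    proof -
      have "contr2 (\<lambda>a b p q. g q b (br (br x a) p)) = - contr2 (\<lambda>a b p q. g q a (br (br x b) p))"
        by (rule contr2_flip1) (auto simp: q)
      also have "\<dots>
          = contr2 (\<lambda>a b p q. g p a (br (br x b) q))" by (subst contr2_flip2) (auto simp: q)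
      also have "\<dots> = contr2 (\<lambda>a b p q. g a p (br (br x q) b))" by (rule contr2_swap)
      finally show ?thesis .
    qed
    moreover have "contr2 (\<lambda>a b p q. g b p (br (br x a) q))
        = - contr2 (\<lambda>a b p q. g a p (br (br x b) q))"
      by (rule contr2_flip1) (auto simp: q)
    moreover have "- contr2 (\<lambda>a b p q. g a p (br x (br b q)))
        = contr2 (\<lambda>a b p q. g a p (br (br x q) b)) + - contr2 (\<lambda>a b p q. g a p (br (br x b) q))"
      unfolding contr2_minus[symmetric] contr2_add[symmetric]
      by (rule contr2_cong) (simp add: br_jacobi trilin_neg_diff[OF g] br_simps x)
    ultimately show ?thesis by simp
  qed
  note D = double_cobracket_delta[OF g x] double_cobracket_delta[OF trilin_rot[OF g] x, unfolded rot_def]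
    double_cobracket_delta[OF trilin_rot[OF trilin_rot[OF g]] x, unfolded rot_def]
  show ?thesis
    unfolding rot_def D
    using cyb0[OF h1] cyb0[OF h2] cyb0[OF h3] t1 t2 t3 t4 t5 t6 j1 j2 j3
    by algebra
qed

lemma lie_bialgebra_delta:
  assumes "CYB s L br r = 0"
  shows "lie_bialgebra s L br \<delta>"
  unfolding lie_bialgebra_def lie_coalgebra_def Let_def
  using lie space_L delta_linear delta_coalternating delta_cocycle delta_co_jacobi[OF assms]
    co_jacobi_iff[OF space_L delta_linear] by simp

end

section \<open>Compatibility with the differential\<close>

text \<open>
  The last assumption is the second part of the differential Yang-Baxter equation,
  \<open>(D \<otimes> id - id \<otimes> d) r = 0\<close>.
\<close>

locale diff_skew_tensor = skew_tensor s L br r n u v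
  for s :: "'k::field \<Rightarrow> 'a::ab_group_add \<Rightarrow> 'a" and L br r n u v +
  fixes lam :: 'k and d D :: "'a \<Rightarrow> 'a"
  assumes diff_lie: "diff_lie_algebra lam s L br d"
    and D_lin: "linear_on s L s L D"
    and admissible: "adjoint_admissible lam s L br d D"
    and intertwine: "tensor_map s L D id r = tensor_map s L id d r"
begin

lemma d_lin: "linear_on s L s L d"
  using diff_lie by (simp add: diff_lie_algebra_def)

lemma dD_in: "x \<in> L \<Longrightarrow> d x \<in> L" "x \<in> L \<Longrightarrow> D x \<in> L"
  using d_lin D_lin by (auto simp: linear_on_def)

lemma d_bracket: "x \<in> L \<Longrightarrow> y \<in> L \<Longrightarrow> d (br x y) = br (d x) y + br x (d y) + s lam (br (d x) (d y))"
  using diff_lie by (simp add: diff_lie_algebra_def)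

lemma contr_D_left:
  assumes "bilin s L \<beta>"
  shows "contr (\<lambda>a b. \<beta> (D a) b) = contr (\<lambda>a b. \<beta> a (d b))"
proof -
  have "r (\<lambda>a b. \<beta> (D a) b) = r (\<lambda>a b. \<beta> a (d b))"
    using fun_cong[OF intertwine, of \<beta>] by (simp add: tensor_map_apply[OF assms])
  then show ?thesis
    using bilin_comp[OF assms D_lin linear_id(2)] bilin_comp[OF assms linear_id(2) d_lin]
    by (simp add: r_contr)
qed

text \<open>
  Flipping \<open>(D \<otimes> id) r = (id \<otimes> d) r\<close> gives \<open>(d \<otimes> id) r = (id \<otimes> D) r\<close>, because \<open>r\<close> is skew.
\<close>

lemma contr_d_left:
  assumes "bilin s L \<beta>"
  shows "contr (\<lambda>a b. \<beta> (d a) b) = contr (\<lambda>a b. \<beta> a (D b))"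
  using contr_skew[OF bilin_comp[OF assms d_lin linear_id(2)]]
    contr_skew[OF bilin_comp[OF assms linear_id(2) D_lin]]
    contr_D_left[OF bilin_flip[OF assms]] by simp

text \<open>
  Admissibility is an identity between functionals, so it says
  \<open>[x, D y] = [d x, y] + D [x, y] + \<lambda> D [d x, y]\<close> after applying any linear form.  This form
  is enough here, since the elements concerned only occur inside bilinear forms.
\<close>

lemma admissible_form:
  assumes f: "linear_on s L (*) UNIV f" and x: "x \<in> L" "y \<in> L"
  shows "f (br x (D y)) = f (br (d x) y) + f (D (br x y)) + lam * f (D (br (d x) y))"
proof -
  let ?f = "\<lambda>x. if x \<in> L then f x else 0"
  have "?f \<in> dual s L"
    using f L_closed by (auto simp: dual_def linear_on_def)
  then have "?f (br x (D y)) = ?f (br (d x) y) + ?f (D (br x y)) + lam * ?f (D (br (d x) y))"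
    by (rule admissible[unfolded adjoint_admissible_iff[OF diff_lie D_lin], rule_format, OF _ x])
  then show ?thesis using x by (simp add: br_simps dD_in)
qed

text \<open>
  Antisymmetry of the bracket turns admissibility into a formula for brackets with \<open>D x\<close>:
  \<open>[D x, y] = [x, d y] + D [x, y] + \<lambda> D [x, d y]\<close>.
\<close>

lemma admissible_form':
  assumes f: "linear_on s L (*) UNIV f" and x: "x \<in> L" "y \<in> L"
  shows "f (br (D x) y) = f (br x (d y)) + f (D (br x y)) + lam * f (D (br x (d y)))"
proof -
  have neg: "f (- z) = - f z" "D (- z) = - D z" if "z \<in> L" for z
    using linear_on_simps(2)[OF f space_L that] linear_on_simps(2)[OF D_lin space_L that] .
  have "br y (D x) = - br (D x) y" "br (d y) x = - br x (d y)" "br y x = - br x y"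
    using br_antisym x dD_in by blast+
  then have "- f (br (D x) y) = - f (br x (d y)) - f (D (br x y)) - lam * f (D (br x (d y)))"
    using admissible_form[OF f x(2,1)] x by (simp add: neg br_simps dD_in)
  then show ?thesis by (simp add: algebra_simps)
qed

text \<open>
  \<open>D\<close> is a coderivation of weight \<open>\<lambda>\<close>.  In each leg, admissibility expands the bracket with \<open>D x\<close>
  into terms with \<open>d\<close> on that leg of \<open>r\<close>, and the intertwining relations move this \<open>d\<close> to the other leg as
  \<open>D\<close>.
\<close>

lemma delta_D:
  assumes x: "x \<in> L" and b: "bilin s L \<beta>"
  shows "\<delta> (D x) \<beta> = \<delta> x (\<lambda>p q. \<beta> (D p) q) + \<delta> x (\<lambda>p q. \<beta> p (D q))
    + lam * \<delta> x (\<lambda>p q. \<beta> (D p) (D q))"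
proof -
  note lin = br_linear(1)[OF x] linear_id(2) D_lin
  note comp = bilin_comp[OF b]
  have Dbr: "linear_on s L s L (\<lambda>a. D (br x a))"
    using D_lin lin(1) by (auto simp: linear_on_def)
  have l: "linear_on s L (*) UNIV (\<lambda>c. \<beta> c b)" "linear_on s L (*) UNIV (\<beta> a)"
    if "a \<in> L" "b \<in> L" for a b
    using b that by (auto simp: bilinear_on_def)
  have left: "contr (\<lambda>a b. \<beta> (br (D x) a) b)
      = contr (\<lambda>a b. \<beta> (br x a) (D b)) + contr (\<lambda>a b. \<beta> (D (br x a)) b)
        + lam * contr (\<lambda>a b. \<beta> (D (br x a)) (D b))"
  proof -
    have "contr (\<lambda>a b. \<beta> (br (D x) a) b) = contr (\<lambda>a b. \<beta> (br x (d a)) b + \<beta> (D (br x a)) b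
        + lam * \<beta> (D (br x (d a))) b)"
      using admissible_form'[OF l(1)] x by (intro contr_cong) blast
    then show ?thesis
      using contr_d_left[OF comp[OF lin(1,2)]] contr_d_left[OF comp[OF Dbr lin(2)]]
      by (simp add: contr_add contr_scale)
  qed
  have right: "contr (\<lambda>a b. \<beta> a (br (D x) b))
      = contr (\<lambda>a b. \<beta> (D a) (br x b)) + contr (\<lambda>a b. \<beta> a (D (br x b)))
        + lam * contr (\<lambda>a b. \<beta> (D a) (D (br x b)))"
  proof -
    have "contr (\<lambda>a b. \<beta> a (br (D x) b)) = contr (\<lambda>a b. \<beta> a (br x (d b)) + \<beta> a (D (br x b))
        + lam * \<beta> a (D (br x (d b))))"
      using admissible_form'[OF l(2)] x by (intro contr_cong) blast
    then show ?thesis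
      using contr_D_left[OF comp[OF lin(2,1)]] contr_D_left[OF comp[OF lin(2) Dbr]]
      by (simp add: contr_add contr_scale)
  qed
  show ?thesis
    using x dD_in left right
    by (simp add: delta_apply b comp[OF lin(3,2)] comp[OF lin(2,3)] comp[OF lin(3,3)] contr_add
      algebra_simps)
qed

text \<open>
  This is the admissibility of \<open>d\<^sup>*\<close> for the dual Lie algebra, before pairing with functionals:
  \<open>(id \<otimes> d) (\<delta> x) = (D \<otimes> id) (\<delta> x) + \<delta> (d x) + \<lambda> (D \<otimes> id) (\<delta> (d x))\<close>.  In the first half
  of \<open>\<delta> x\<close> one moves \<open>d\<close> over to the first leg as \<open>D\<close> and uses admissibility; in the second half one uses
  that \<open>d\<close> is a derivation of weight \<open>\<lambda>\<close> and then moves the remaining \<open>d\<close>'s.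
\<close>

lemma delta_d:
  assumes x: "x \<in> L" and b: "bilin s L \<beta>"
  shows "\<delta> x (\<lambda>p q. \<beta> p (d q)) = \<delta> x (\<lambda>p q. \<beta> (D p) q) + \<delta> (d x) \<beta>
    + lam * \<delta> (d x) (\<lambda>p q. \<beta> (D p) q)"
proof -
  have dx: "d x \<in> L" using x by (rule dD_in)
  note lin = br_linear(1)[OF x] br_linear(1)[OF dx] linear_id(2) D_lin d_lin
  note comp = bilin_comp[OF b]
  have l: "linear_on s L (*) UNIV (\<lambda>c. \<beta> c b)" "linear_on s L (*) UNIV (\<beta> a)"
    if "a \<in> L" "b \<in> L" for a b
    using b that by (auto simp: bilinear_on_def)
  have left: "contr (\<lambda>a b. \<beta> (br x a) (d b)) = contr (\<lambda>a b. \<beta> (br (d x) a) b)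
      + contr (\<lambda>a b. \<beta> (D (br x a)) b) + lam * contr (\<lambda>a b. \<beta> (D (br (d x) a)) b)"
  proof -
    have "contr (\<lambda>a b. \<beta> (br x a) (d b)) = contr (\<lambda>a b. \<beta> (br x (D a)) b)"
      using contr_D_left[OF comp[OF lin(1,3)]] by simp
    also have "\<dots> = contr (\<lambda>a b. \<beta> (br (d x) a) b + \<beta> (D (br x a)) b
        + lam * \<beta> (D (br (d x) a)) b)"
      using admissible_form[OF l(1)] x by (intro contr_cong) blast
    finally show ?thesis by (simp add: contr_add contr_scale)
  qed
  have right: "contr (\<lambda>a b. \<beta> a (d (br x b))) = contr (\<lambda>a b. \<beta> a (br (d x) b))
      + contr (\<lambda>a b. \<beta> (D a) (br x b)) + lam * contr (\<lambda>a b. \<beta> (D a) (br (d x) b))"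
  proof -
    have "contr (\<lambda>a b. \<beta> a (d (br x b))) = contr (\<lambda>a b. \<beta> a (br (d x) b) + \<beta> a (br x (d b))
        + lam * \<beta> a (br (d x) (d b)))"
      using l(2) x by (intro contr_cong) (simp add: d_bracket linear_on_def br_simps dD_in L_closed)
    then show ?thesis
      using contr_D_left[OF comp[OF lin(3,1)]] contr_D_left[OF comp[OF lin(3,2)]]
      by (simp add: contr_add contr_scale)
  qed
  show ?thesis
    using left right
    by (simp add: delta_apply b x dx comp[OF lin(3,5)] comp[OF lin(4,3)] contr_add algebra_simps)
qed

lemma diff_lie_coalgebra_delta:
  assumes "CYB s L br r = 0"
  shows "diff_lie_coalgebra lam s L \<delta> D"
proof -
  have "\<delta> (D x) = tensor_map s L D id (\<delta> x) + tensor_map s L id D (\<delta> x)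
      + fscale lam (tensor_map s L D D (\<delta> x))" if x: "x \<in> L" for x
  proof (rule tensor_eqI[OF _ _ space_L])
    show "\<delta> (D x) \<beta> = (tensor_map s L D id (\<delta> x) + tensor_map s L id D (\<delta> x)
      + fscale lam (tensor_map s L D D (\<delta> x))) \<beta>" if b: "bilin s L \<beta>" for \<beta>
      using delta_D[OF x b] by (simp add: tensor_map_apply[OF b] fscale_def)
  qed (intro space_on_closed[OF space_on_tensor_space] tensor_map_in_tensor2 delta_in space_L D_lin
      linear_id dD_in x)+
  then show ?thesis
    using lie_bialgebra_delta[OF assms] D_lin by (simp add: diff_lie_coalgebra_def lie_bialgebra_def)
qed

lemma dual_adjoint_admissible:
  assumes "CYB s L br r = 0"
  shows "adjoint_admissible lam fscale (dual s L) (dual_bracket L \<delta>) (transpose_on L D)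
    (transpose_on L d)"
proof -
  note dual_alg = dual_diff_lie_algebra[OF diff_lie_coalgebra_delta[OF assms]]
  let ?b = "dual_bracket L \<delta>" and ?D = "transpose_on L D" and ?d = "transpose_on L d"
  have bl: "?b p q \<in> dual s L" if "p \<in> dual s L" "q \<in> dual s L" for p q
    using dual_alg that by (auto simp: diff_lie_algebra_def lie_algebra_def bilinear_on_def linear_on_def)
  have Dl: "?D p \<in> dual s L" "?d p \<in> dual s L" if "p \<in> dual s L" for p
    using transpose_on_linear[OF D_lin space_L] transpose_on_linear[OF d_lin space_L] that
    by (auto simp: linear_on_def)
  have eq: "?b a (?d b) = ?b (?D a) b + ?d (?b a b) + fscale lam (?d (?b (?D a) b))"
    if ab: "a \<in> dual s L" "b \<in> dual s L" for a b
  proof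
    fix x
    show "?b a (?d b) x = (?b (?D a) b + ?d (?b a b) + fscale lam (?d (?b (?D a) b))) x"
    proof (cases "x \<in> L")
      case True
      have tr: "\<delta> y (\<lambda>p q. a p * ?d b q) = \<delta> y (\<lambda>p q. a p * b (d q))"
        "\<delta> y (\<lambda>p q. ?D a p * b q) = \<delta> y (\<lambda>p q. a (D p) * b q)" if "y \<in> L" for y
        by (rule tensor_cong[OF delta_in[OF that] space_L space_L], simp add: transpose_on_def)+
      have dt: "?d f x = f (d x)" for f :: "'a \<Rightarrow> 'k"
        using True by (simp add: transpose_on_def)
      show ?thesis
        using delta_d[OF True dual_bilin[OF ab]] True dD_in(1)[OF True]
        by (simp add: dt dual_bracket_def tensor_pair_def tr fscale_def)
    qed (simp add: transpose_on_def dual_bracket_def fscale_def)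
  qed
  show ?thesis
    unfolding adjoint_admissible_iff[OF dual_alg transpose_on_linear[OF d_lin space_L]]
  proof (intro ballI)
    fix F a b assume F: "F \<in> dual fscale (dual s L)" and ab: "a \<in> dual s L" "b \<in> dual s L"
    have lin: "F (p + q) = F p + F q" "F (fscale c p) = c * F p"
      if "p \<in> dual s L" "q \<in> dual s L" for p q c
      using F that by (auto simp: dual_def linear_on_def)
    show "F (?b a (?d b)) = F (?b (?D a) b) + F (?d (?b a b)) + lam * F (?d (?b (?D a) b))"
      unfolding eq[OF ab] using ab
      by (simp add: lin bl Dl space_on_closed[OF space_on_dual[OF space_L]])
  qed
qed

end

theorem theorem3p21:
  fixes s :: "'k::field \<Rightarrow> 'a::ab_group_add \<Rightarrow> 'a"
    and L :: "'a set"
    and br :: "'a \<Rightarrow> 'a \<Rightarrow> 'a"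
    and d D :: "'a \<Rightarrow> 'a"
    and lam :: 'k
    and r :: "('a \<Rightarrow> 'a \<Rightarrow> 'k) \<Rightarrow> 'k"
  assumes "finite_dim_space_on s L"
    and "diff_lie_algebra lam s L br d"
    and "linear_on s L s L D"
    and "adjoint_admissible lam s L br d D"
    and "r \<in> tensor2 s L"
    and "diff_CYBE_solution s L br d D r"
    and "r = - flip s L r"
  shows "diff_lie_bialgebra lam s L br d (delta_r s L br r) D"
proof -
  have lie: "lie_algebra s L br" using assms(2) by (simp add: diff_lie_algebra_def)
  then have sp: "space_on s L" by (simp add: lie_algebra_def)
  obtain n u v where "\<And>i. i < n \<Longrightarrow> u (i::nat) \<in> L" "\<And>i. i < n \<Longrightarrow> v i \<in> L"
    "\<And>\<beta>. r \<beta> = (if bilin s L \<beta> then \<Sum>i<n. \<beta> (u i) (v i) else 0)"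
    by (rule tensor_space_sum[OF assms(5) sp], rule that)
  then interpret diff_skew_tensor s L br r n u v lam d D
    using assms lie by unfold_locales (auto simp: diff_CYBE_solution_def)
  have "CYB s L br r = 0" using assms(6) by (simp add: diff_CYBE_solution_def)
  then show ?thesis
    unfolding diff_lie_bialgebra_def
    using assms(2,4) lie_bialgebra_delta diff_lie_coalgebra_delta dual_adjoint_admissible by simp
qed

end
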